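(* If $H$ is any Halin graph, then $b_e(H)\le 2$. This bound is tight, i.e. there exists a Halin graph $H$ with $b_e(H)=2$.
   Context: All graphs are finite and simple. A Halin graph is a simple planar graph $G=T\cup C$ with no vertex of degree $2$, where $T$ is a tree and $C$ is a simple cycle (on at least three vertices) whose vertex set is exactly the set of all leaves of $T$ ($C$ is induced by the leaves of $T$). For an integer $k\ge 0$, a $k$-bend path is a piecewise linear simple curve in the plane made up of $k+1$ line segments, each of which is horizontal or vertical, with consecutive segments being of different orientation. A $B_k$-EPG representation of a graph $G$ is a collection of $k$-bend paths $\{P_u\}_{u\in V(G)}$ such that for distinct $u,v\in V(G)$, $uv\in E(G)$ if and only if $P_u$ and $P_v$ have a horizontal or vertical line segment of non-zero length in common. The EPG bend-number $b_e(G)$ is the minimum $k$ such that $G$ has a $B_k$-EPG representation. *)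

theory Defs
  imports "HOL-Analysis.Analysis" "HOL-Library.Extended_Nat"
begin

section \<open>Finite simple graphs\<close>

text \<open>A graph is given by its vertex set \<open>V\<close> and its set \<open>E\<close> of two-element edges.\<close>

definition simple_graph :: "'a set \<Rightarrow> 'a set set \<Rightarrow> bool" where
  "simple_graph V E \<longleftrightarrow> finite V \<and> (\<forall>e\<in>E. e \<subseteq> V \<and> card e = 2)"

definition vertex_degree :: "'a set set \<Rightarrow> 'a \<Rightarrow> nat" where
  "vertex_degree E v = card {e \<in> E. v \<in> e}"

definition connected_graph :: "'a set \<Rightarrow> 'a set set \<Rightarrow> bool" where
  "connected_graph V E \<longleftrightarrow>
     V \<noteq> {} \<and> (\<forall>u\<in>V. \<forall>v\<in>V. (u, v) \<in> {(x, y). {x, y} \<in> E}\<^sup>*)"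

definition cycle_graph :: "'a set \<Rightarrow> 'a set set \<Rightarrow> bool" where
  "cycle_graph V E \<longleftrightarrow>
     (\<exists>vs. distinct vs \<and> length vs \<ge> 3 \<and> set vs = V \<and>
           E = {{vs ! i, vs ! (Suc i mod length vs)} | i. i < length vs})"

definition acyclic_graph :: "'a set set \<Rightarrow> bool" where
  "acyclic_graph E \<longleftrightarrow> \<not> (\<exists>W F. F \<subseteq> E \<and> cycle_graph W F)"

definition tree_graph :: "'a set \<Rightarrow> 'a set set \<Rightarrow> bool" where
  "tree_graph V E \<longleftrightarrow> simple_graph V E \<and> connected_graph V E \<and> acyclic_graph E"


section \<open>Planar graphs and Halin graphs\<close>

text \<open>The plane is \<^typ>\<open>complex\<close>, as in the Jordan curve theorem of the library.
  In a drawing, \<open>p\<close> places the vertices and \<open>\<gamma> e\<close> is the arc drawn for the edge \<open>e\<close>;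
  it passes through no vertices but its endpoints, and distinct edges meet only in the
  images of common endpoints.\<close>

definition plane_drawing ::
    "'a set \<Rightarrow> 'a set set \<Rightarrow> ('a \<Rightarrow> complex) \<Rightarrow> ('a set \<Rightarrow> real \<Rightarrow> complex) \<Rightarrow> bool" where
  "plane_drawing V E p \<gamma> \<longleftrightarrow>
     inj_on p V \<and>
     (\<forall>e\<in>E. arc (\<gamma> e) \<and> {pathstart (\<gamma> e), pathfinish (\<gamma> e)} = p ` e \<and>
            path_image (\<gamma> e) \<inter> p ` V = p ` e) \<and>
     (\<forall>e\<in>E. \<forall>f\<in>E. e \<noteq> f \<longrightarrow> path_image (\<gamma> e) \<inter> path_image (\<gamma> f) \<subseteq> p ` (e \<inter> f))"

definition planar_graph :: "'a set \<Rightarrow> 'a set set \<Rightarrow> bool" where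
  "planar_graph V E \<longleftrightarrow> (\<exists>p \<gamma>. plane_drawing V E p \<gamma>)"

definition leaves :: "'a set \<Rightarrow> 'a set set \<Rightarrow> 'a set" where
  "leaves V E = {v \<in> V. vertex_degree E v = 1}"

definition halin_graph :: "'a set \<Rightarrow> 'a set set \<Rightarrow> bool" where
  "halin_graph V E \<longleftrightarrow>
     simple_graph V E \<and> planar_graph V E \<and> (\<forall>v\<in>V. vertex_degree E v \<noteq> 2) \<and>
     (\<exists>T C. E = T \<union> C \<and> tree_graph V T \<and> cycle_graph (leaves V T) C)"


section \<open>EPG representations and the bend-number\<close>

definition horizontal :: "complex \<Rightarrow> complex \<Rightarrow> bool" where
  "horizontal a b \<longleftrightarrow> a \<noteq> b \<and> Im a = Im b"

definition vertical :: "complex \<Rightarrow> complex \<Rightarrow> bool" where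
  "vertical a b \<longleftrightarrow> a \<noteq> b \<and> Re a = Re b"

text \<open>The values at lists of length less than two are irrelevant.\<close>

fun polyline :: "complex list \<Rightarrow> real \<Rightarrow> complex" where
  "polyline [] = linepath 0 0"
| "polyline [a] = linepath a a"
| "polyline [a, b] = linepath a b"
| "polyline (a # b # c # ps) = linepath a b +++ polyline (b # c # ps)"

text \<open>The list \<open>ps\<close> consists of the two ends of the path and its \<open>k\<close> bends in between.\<close>

definition bend_path :: "nat \<Rightarrow> (real \<Rightarrow> complex) \<Rightarrow> bool" where
  "bend_path k g \<longleftrightarrow> simple_path g \<and>
     (\<exists>ps. length ps = k + 2 \<and> g = polyline ps \<and>
        (\<forall>i\<le>k. horizontal (ps ! i) (ps ! (i + 1)) \<or> vertical (ps ! i) (ps ! (i + 1))) \<and>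
        (\<forall>i<k. horizontal (ps ! i) (ps ! (i + 1)) \<longleftrightarrow> vertical (ps ! (i + 1)) (ps ! (i + 2))))"

definition share_segment :: "(real \<Rightarrow> complex) \<Rightarrow> (real \<Rightarrow> complex) \<Rightarrow> bool" where
  "share_segment g h \<longleftrightarrow>
     (\<exists>a b. (horizontal a b \<or> vertical a b) \<and>
            closed_segment a b \<subseteq> path_image g \<inter> path_image h)"

definition EPG_representation ::
    "nat \<Rightarrow> 'a set \<Rightarrow> 'a set set \<Rightarrow> ('a \<Rightarrow> real \<Rightarrow> complex) \<Rightarrow> bool" where
  "EPG_representation k V E P \<longleftrightarrow>
     (\<forall>u\<in>V. bend_path k (P u)) \<and>
     (\<forall>u\<in>V. \<forall>v\<in>V. u \<noteq> v \<longrightarrow> ({u, v} \<in> E \<longleftrightarrow> share_segment (P u) (P v)))"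

text \<open>The infimum is \<open>\<infinity>\<close> if there is no representation for any \<open>k\<close>, so that a finite
  bound on the bend-number entails the existence of a representation.\<close>

definition EPG_bend_number :: "'a set \<Rightarrow> 'a set set \<Rightarrow> enat" where
  "EPG_bend_number V E = (INF k \<in> {k. \<exists>P. EPG_representation k V E P}. enat k)"

end

theory Submission
  imports Defs
begin

text \<open>Upper bound: choose a leaf \<open>w\<close> and root the tree at its neighbour. An inner
  vertex occupies a row of its own and then descends its column to touch the row of its parent; a leaf
  occupies a column, running from a piece of row \<open>0\<close>, shared with the next leaf of the cycle,
  to the row of its parent. The remaining leaf \<open>w\<close> closes the cycle by a U-shaped path.

  Tightness: the wheel with five spokes has no representation with at most one bend. Among the rim
  paths that share a segment with the horizontal arm of the hub, one reaching farthest from the corner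
  of the hub would, unless it reaches that corner, lie in a cycle of length four. So these paths share
  a segment at the corner and form a clique, and so do those sharing a segment with the vertical arm.
  But a cycle of length five is not covered by two cliques.\<close>

section \<open>Axis-parallel segments\<close>

text \<open>Rows and columns may cross freely, since a single common point is no common segment. In
  the layout it therefore suffices that each child reaches the row of its parent, and that pieces of
  non-adjacent vertices never share a stretch of one line. Numbering the leaves first, in cyclic
  order, and the inner vertices so that parents come after their children gives both. The obstacle
  is the edge that closes the cycle: its ends lie in columns far apart, and the three segments of an
  ordinary leaf are all in use. So \<open>w\<close> gives up a column of its own and the usual
  contact with the row of its parent. Rooting the tree at the neighbour of \<open>w\<close> makes up
  for this: the root has no parent to reach and thus has one segment to spare for \<open>w\<close>.
  Five is the least possible number of spokes for the counting argument: a triangle is a clique, and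
  a cycle of length four is covered by two opposite edges.\<close>

fun axis_segment :: "bool \<times> real \<times> real \<times> real \<Rightarrow> complex set" where
  "axis_segment (True, c, l, r) = {z. Im z = c \<and> l \<le> Re z \<and> Re z \<le> r}"
| "axis_segment (False, c, l, r) = {z. Re z = c \<and> l \<le> Im z \<and> Im z \<le> r}"

text \<open>The strict inequality demands a common stretch of positive length; in particular a
  degenerate segment overlaps nothing.\<close>

fun overlap :: "bool \<times> real \<times> real \<times> real \<Rightarrow> bool \<times> real \<times> real \<times> real \<Rightarrow> bool" where
  "overlap (d, c, l, r) (d', c', l', r') \<longleftrightarrow> d = d' \<and> c = c' \<and> max l l' < min r r'"

lemma closed_segment_horizontal:
  "Im a = Im b \<Longrightarrow> closed_segment a b = axis_segment (True, Im a, min (Re a) (Re b), max (Re a) (Re b))"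
  by (auto simp: closed_segment_same_Im closed_segment_eq_real_ivl)

lemma closed_segment_vertical:
  "Re a = Re b \<Longrightarrow> closed_segment a b = axis_segment (False, Re a, min (Im a) (Im b), max (Im a) (Im b))"
  by (auto simp: closed_segment_same_Re closed_segment_eq_real_ivl)

lemma overlap_if_common_points:
  assumes "x \<in> axis_segment s" "x \<in> axis_segment t" "y \<in> axis_segment s" "y \<in> axis_segment t"
    and "x \<noteq> y"
    and "Im x = Im y \<or> Re x = Re y"
  shows "overlap s t"
  using assms
  by (cases s rule: axis_segment.cases; cases t rule: axis_segment.cases)
     (auto simp: complex_eq_iff)

lemma overlap_imp_segment:
  assumes "overlap s t"
  obtains a b where "horizontal a b \<or> vertical a b"
    "closed_segment a b \<subseteq> axis_segment s \<inter> axis_segment t"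
proof -
  obtain d c l r l' r' where st: "s = (d, c, l, r)" "t = (d, c, l', r')"
    and lr: "max l l' < min r r'"
    using assms by (cases s; cases t) auto
  define L U where "L = max l l'" and "U = min r r'"
  have LU: "L < U" "l \<le> L" "l' \<le> L" "U \<le> r" "U \<le> r'"
    using lr by (simp_all add: L_def U_def)
  then have [simp]: "min L U = L" "max L U = U" by simp_all
  show thesis
  proof (cases d)
    case True
    show thesis
    proof (rule that[of "Complex L c" "Complex U c"])
      show "closed_segment (Complex L c) (Complex U c) \<subseteq> axis_segment s \<inter> axis_segment t"
        using LU by (auto simp: closed_segment_horizontal st True)
    qed (use LU in \<open>simp add: horizontal_def\<close>)
  next
    case False
    show thesis
    proof (rule that[of "Complex c L" "Complex c U"])
      show "closed_segment (Complex c L) (Complex c U) \<subseteq> axis_segment s \<inter> axis_segment t"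
        using LU by (auto simp: closed_segment_vertical st False)
    qed (use LU in \<open>simp add: vertical_def\<close>)
  qed
qed

text \<open>A common segment may spread over several pieces of either path. But it is infinite and
  covered by finitely many intersections of a piece of \<open>g\<close> with a piece of
  \<open>h\<close>, so some pair of pieces has two distinct points in common and hence overlaps.
  This turns adjacency of paths into arithmetic on endpoints.\<close>

lemma share_segment_iff_overlap:
  assumes "finite A" "finite B"
    and g: "path_image g = (\<Union>s\<in>A. axis_segment s)" and h: "path_image h = (\<Union>t\<in>B. axis_segment t)"
  shows "share_segment g h \<longleftrightarrow> (\<exists>s\<in>A. \<exists>t\<in>B. overlap s t)"
proof
  assume "share_segment g h"
  then obtain a b where ab: "horizontal a b \<or> vertical a b"
    and sub: "closed_segment a b \<subseteq> path_image g \<inter> path_image h"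
    unfolding share_segment_def by blast
  have "a \<noteq> b" using ab by (auto simp: horizontal_def vertical_def)
  then have inf: "infinite (closed_segment a b)" by simp
  have "closed_segment a b \<subseteq> (\<Union>u\<in>A \<times> B. closed_segment a b \<inter> axis_segment (fst u) \<inter> axis_segment (snd u))"
  proof
    fix z assume z: "z \<in> closed_segment a b"
    with sub have "z \<in> \<Union> (axis_segment ` A)" "z \<in> \<Union> (axis_segment ` B)" unfolding g h by blast+
    then obtain s t where "s \<in> A" "t \<in> B" "z \<in> axis_segment s" "z \<in> axis_segment t" by blast
    with z show "z \<in> (\<Union>u\<in>A \<times> B. closed_segment a b \<inter> axis_segment (fst u) \<inter> axis_segment (snd u))"
      by (intro UN_I[of "(s, t)"]) simp_all
  qed
  with inf have "\<not> finite (\<Union>u\<in>A \<times> B. closed_segment a b \<inter> axis_segment (fst u) \<inter> axis_segment (snd u))"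
    by (meson finite_subset)
  then obtain u where u: "u \<in> A \<times> B"
    and inf': "infinite (closed_segment a b \<inter> axis_segment (fst u) \<inter> axis_segment (snd u))"
    by (simp only: finite_UN[OF finite_cartesian_product[OF assms(1,2)]]) blast
  define s t where "s = fst u" and "t = snd u"
  have st: "s \<in> A" "t \<in> B" using u by (auto simp: s_def t_def)
  note inf' = inf'[folded s_def t_def]
  then obtain x where x: "x \<in> closed_segment a b \<inter> axis_segment s \<inter> axis_segment t"
    using infinite_imp_nonempty by blast
  have "infinite (closed_segment a b \<inter> axis_segment s \<inter> axis_segment t - {x})"
    using inf' by (rule infinite_remove)
  then obtain y where y: "y \<in> closed_segment a b \<inter> axis_segment s \<inter> axis_segment t" "y \<noteq> x"
    using infinite_imp_nonempty by blast
  have "Im x = Im y \<or> Re x = Re y"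
    using ab
  proof
    assume "horizontal a b"
    then have "Im z = Im a" if "z \<in> closed_segment a b" for z
      using that closed_segment_horizontal[of a b] unfolding horizontal_def axis_segment.simps by blast
    from this[of x] this[of y] show ?thesis using x y by simp
  next
    assume "vertical a b"
    then have "Re z = Re a" if "z \<in> closed_segment a b" for z
      using that closed_segment_vertical[of a b] unfolding vertical_def axis_segment.simps by blast
    from this[of x] this[of y] show ?thesis using x y by simp
  qed
  with x y st show "\<exists>s\<in>A. \<exists>t\<in>B. overlap s t"
    by (intro bexI[of _ s] bexI[of _ t] overlap_if_common_points[of x _ _ y]) simp_all
next
  assume "\<exists>s\<in>A. \<exists>t\<in>B. overlap s t"
  then obtain s t where "s \<in> A" "t \<in> B" "overlap s t" by blast
  then show "share_segment g h"
    unfolding share_segment_def g h by (elim overlap_imp_segment) blast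
qed

section \<open>Paths with at most one bend\<close>


text \<open>The endpoints of each interval may come in either order, so arms pointing in either
  direction are treated alike and reflections preserve the relation.\<close>

definition ivl_overlap :: "real \<Rightarrow> real \<Rightarrow> real \<Rightarrow> real \<Rightarrow> bool" where
  "ivl_overlap x y u v \<longleftrightarrow> max (min x y) (min u v) < min (max x y) (max u v)"

lemma ivl_overlap_minus [simp]: "ivl_overlap (- x) (- y) (- u) (- v) = ivl_overlap x y u v"
  unfolding ivl_overlap_def minus_max_eq_min[symmetric] minus_min_eq_max[symmetric] neg_less_iff_less ..

lemma ivl_overlap_commute: "ivl_overlap x y u v = ivl_overlap u v x y"
  by (simp add: ivl_overlap_def max.commute min.commute)

text \<open>An elbow \<open>(a, b, p, q)\<close> has its corner at \<open>(a, b)\<close>, the end of its horizontal arm at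
  \<open>(p, b)\<close> and that of its vertical arm at \<open>(a, q)\<close>. Arms may be degenerate, so that paths
  without bends are elbows as well.\<close>

fun elbow_segments :: "real \<times> real \<times> real \<times> real \<Rightarrow> (bool \<times> real \<times> real \<times> real) set" where
  "elbow_segments (a, b, p, q) = {(True, b, min a p, max a p), (False, a, min b q, max b q)}"

fun horizontal_overlap :: "real \<times> real \<times> real \<times> real \<Rightarrow> real \<times> real \<times> real \<times> real \<Rightarrow> bool" where
  "horizontal_overlap (a, b, p, q) (a', b', p', q') \<longleftrightarrow> b = b' \<and> ivl_overlap a p a' p'"

fun vertical_overlap :: "real \<times> real \<times> real \<times> real \<Rightarrow> real \<times> real \<times> real \<times> real \<Rightarrow> bool" where
  "vertical_overlap (a, b, p, q) (a', b', p', q') \<longleftrightarrow> a = a' \<and> ivl_overlap b q b' q'"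

definition elbow_adjacent :: "real \<times> real \<times> real \<times> real \<Rightarrow> real \<times> real \<times> real \<times> real \<Rightarrow> bool" where
  "elbow_adjacent s t \<longleftrightarrow> horizontal_overlap s t \<or> vertical_overlap s t"

lemma elbow_adjacent_iff_overlap:
  "elbow_adjacent s t \<longleftrightarrow> (\<exists>x\<in>elbow_segments s. \<exists>y\<in>elbow_segments t. overlap x y)"
  by (cases s; cases t) (simp add: elbow_adjacent_def ivl_overlap_def del: max_less_iff_conj min_less_iff_conj)

fun transpose_elbow :: "real \<times> real \<times> real \<times> real \<Rightarrow> real \<times> real \<times> real \<times> real" where
  "transpose_elbow (a, b, p, q) = (b, a, q, p)"

fun reflect_elbow :: "real \<times> real \<times> real \<times> real \<Rightarrow> real \<times> real \<times> real \<times> real" where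
  "reflect_elbow (a, b, p, q) = (- a, b, - p, q)"

lemma horizontal_overlap_reflect [simp]:
  "horizontal_overlap (reflect_elbow s) (reflect_elbow t) = horizontal_overlap s t"
  by (cases s; cases t) simp

lemma vertical_overlap_reflect [simp]:
  "vertical_overlap (reflect_elbow s) (reflect_elbow t) = vertical_overlap s t"
  by (cases s; cases t) simp

lemma horizontal_overlap_transpose [simp]:
  "horizontal_overlap (transpose_elbow s) (transpose_elbow t) = vertical_overlap s t"
  by (cases s; cases t) simp

lemma vertical_overlap_transpose [simp]:
  "vertical_overlap (transpose_elbow s) (transpose_elbow t) = horizontal_overlap s t"
  by (cases s; cases t) simp

lemma elbow_adjacent_reflect [simp]:
  "elbow_adjacent (reflect_elbow s) (reflect_elbow t) = elbow_adjacent s t"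
  by (simp add: elbow_adjacent_def)

lemma elbow_adjacent_transpose [simp]:
  "elbow_adjacent (transpose_elbow s) (transpose_elbow t) = elbow_adjacent s t"
  by (auto simp: elbow_adjacent_def)

lemma elbow_adjacent_sym: "elbow_adjacent s t \<Longrightarrow> elbow_adjacent t s"
  by (cases s; cases t) (auto simp: elbow_adjacent_def ivl_overlap_commute)

text \<open>What is used of induced cycles of length at least five.\<close>

definition long_cycle_like :: "'i set \<Rightarrow> ('i \<Rightarrow> 'i \<Rightarrow> bool) \<Rightarrow> bool" where
  "long_cycle_like R adj \<longleftrightarrow> finite R \<and>
     (\<forall>i\<in>R. \<exists>j\<in>R. \<exists>k\<in>R. j \<noteq> i \<and> k \<noteq> i \<and> j \<noteq> k \<and> adj i j \<and> adj i k \<and> \<not> adj j k) \<and>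
     (\<forall>i\<in>R. \<forall>m\<in>R. \<forall>j\<in>R. \<forall>k\<in>R. distinct [i, m, j, k] \<longrightarrow>
        adj i j \<longrightarrow> adj i k \<longrightarrow> adj m j \<longrightarrow> adj m k \<longrightarrow> adj j k)"

section \<open>Rim paths along one arm of the hub\<close>

lemma long_cycle_like_neighbours:
  assumes "long_cycle_like R adj" "i \<in> R"
  obtains j k where "j \<in> R" "k \<in> R" "j \<noteq> i" "k \<noteq> i" "j \<noteq> k" "adj i j" "adj i k" "\<not> adj j k"
  using assms unfolding long_cycle_like_def by blast

lemma long_cycle_like_C4:
  assumes "long_cycle_like R adj" "i \<in> R" "m \<in> R" "j \<in> R" "k \<in> R" "distinct [i, m, j, k]"
    "adj i j" "adj i k" "adj m j" "adj m k"
  shows "adj j k"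
  using assms unfolding long_cycle_like_def by blast

text \<open>Every arm in \<open>S\<close> reaches beyond \<open>a0\<close> to the right. Once every
  left end is known to be at most \<open>a0\<close>, any two of these arms share a stretch just to
  the right of \<open>a0\<close>.\<close>

lemma horizontal_neighbours_clique_right:
  fixes e :: "'i \<Rightarrow> real \<times> real \<times> real \<times> real"
  assumes R: "long_cycle_like R (\<lambda>i j. elbow_adjacent (e i) (e j))"
    and hub: "h = (a0, b0, p0, q0)" "a0 < p0"
    and hub_adj: "\<And>i. i \<in> R \<Longrightarrow> elbow_adjacent h (e i)"
    and xy: "x \<in> R" "y \<in> R" "horizontal_overlap h (e x)" "horizontal_overlap h (e y)"
  shows "elbow_adjacent (e x) (e y)"
proof -
  define S where "S = {i \<in> R. horizontal_overlap h (e i)}"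
  define a b p q where "a i = fst (e i)" and "b i = fst (snd (e i))"
    and "p i = fst (snd (snd (e i)))" and "q i = snd (snd (snd (e i)))" for i
  have e: "e i = (a i, b i, p i, q i)" for i by (simp add: a_def b_def p_def q_def)
  define l r where "l i = min (a i) (p i)" and "r i = max (a i) (p i)" for i
  have S: "b i = b0" "a0 < r i" "l i < p0" "l i < r i" if "i \<in> S" for i
    using that hub by (auto simp: S_def e ivl_overlap_def l_def r_def)
  have adjI: "elbow_adjacent (e i) (e j)" if "i \<in> S" "j \<in> S" "l i < r j" "l j < r i" for i j
    using S[OF that(1)] S[OF that(2)] that(3,4)
    by (auto simp: elbow_adjacent_def e ivl_overlap_def l_def r_def)
  \<comment> \<open>Extremal argument: consider the arms whose left end is the maximum
    \<open>M\<close>, assumed to lie to the right of \<open>a0\<close>.\<close>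
  have "l i \<le> a0" if "i \<in> S" for i
  proof (rule ccontr)
    assume "\<not> l i \<le> a0"
    define M where "M = Max (l ` S)"
    have finS: "finite S" using R by (simp add: S_def long_cycle_like_def)
    have le_M: "l i \<le> M" if "i \<in> S" for i
      using that finS by (simp add: M_def)
    have "M > a0" using le_M[OF that] \<open>\<not> l i \<le> a0\<close> by simp
    have "M \<in> l ` S" unfolding M_def using finS that by (intro Max_in) auto
    then obtain i where i: "i \<in> S" "l i = M" by auto
    \<comment> \<open>A rim path outside \<open>S\<close> has its corner in the column
      \<open>a0\<close>, and if it uses the row of the hub, its arm points left; so it cannot touch
      \<open>i\<close>, which stays to the right on that row and whose corner is in another column.
      A neighbour with \<open>r z = M\<close> touches \<open>i\<close> in the column at
      \<open>M\<close>, one with \<open>r z > M\<close> reaches past it.\<close>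
    have nbr_cases: "z \<in> S \<and> (r z > M \<or> r z = M)"
      if "i \<in> S" "l i = M" "z \<in> R" "elbow_adjacent (e i) (e z)" for i z
    proof -
      have "z \<in> S"
      proof (rule ccontr)
        assume "z \<notin> S"
        then have nh: "\<not> horizontal_overlap h (e z)" and "vertical_overlap h (e z)"
          using that hub_adj by (auto simp: S_def elbow_adjacent_def)
        then have az: "a z = a0" by (simp add: hub e)
        have "p z \<le> a0" if "b z = b0"
          using nh that \<open>a0 < p0\<close> by (auto simp: e hub az ivl_overlap_def)
        moreover have "a i \<noteq> a0" using \<open>l i = M\<close> \<open>M > a0\<close> by (auto simp: l_def)
        ultimately show False
          using \<open>elbow_adjacent (e i) (e z)\<close> S[OF \<open>i \<in> S\<close>] \<open>l i = M\<close> \<open>M > a0\<close>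
          by (auto simp: elbow_adjacent_def e az ivl_overlap_def l_def r_def)
      qed
      moreover have "r z \<ge> M"
        using \<open>elbow_adjacent (e i) (e z)\<close> \<open>l i = M\<close>
        by (auto simp: elbow_adjacent_def e ivl_overlap_def l_def r_def min_def max_def split: if_splits)
      ultimately show ?thesis by auto
    qed
    have split_nbrs: "\<exists>j\<in>S. \<exists>k\<in>S. j \<noteq> i \<and> k \<noteq> i \<and> j \<noteq> k \<and> r j = M \<and> l k = M \<and>
        elbow_adjacent (e i) (e j) \<and> elbow_adjacent (e i) (e k) \<and> \<not> elbow_adjacent (e j) (e k)"
      if i: "i \<in> S" "l i = M" for i
    proof -
      have "i \<in> R" using i by (simp add: S_def)
      \<comment> \<open>If \<open>k\<close> began before \<open>M\<close>, it would overlap the arm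
        of \<open>j\<close>, which ends at \<open>M\<close>. So the neighbour reaching past
        \<open>M\<close> attains the maximum too, and the argument can be repeated for it.\<close>
      have wlog: "l k = M" if "j \<in> S" "k \<in> S" "r j = M" "r k > M" "\<not> elbow_adjacent (e j) (e k)" for j k
      proof -
        have "l j < r k" using le_M[OF that(1)] that(4) by simp
        then have "\<not> l k < M" using adjI[OF that(1,2)] that(3,5) by auto
        then show ?thesis using le_M[OF that(2)] by simp
      qed
      obtain j k where jk: "j \<in> R" "k \<in> R" "j \<noteq> i" "k \<noteq> i" "j \<noteq> k"
        "elbow_adjacent (e i) (e j)" "elbow_adjacent (e i) (e k)" "\<not> elbow_adjacent (e j) (e k)"
        by (rule long_cycle_like_neighbours[OF R \<open>i \<in> R\<close>])
      have jS: "j \<in> S" "r j > M \<or> r j = M" and kS: "k \<in> S" "r k > M \<or> r k = M"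
        using nbr_cases[OF i jk(1,6)] nbr_cases[OF i jk(2,7)] by simp_all
      \<comment> \<open>All left ends are at most \<open>M\<close>: two arms reaching past
        \<open>M\<close> overlap to the right of it, and two arms ending at \<open>M\<close> overlap
        to the left of it. Hence non-adjacent neighbours are one of each kind.\<close>
      have "\<not> (r j > M \<and> r k > M)" "\<not> (r j = M \<and> r k = M)"
        using adjI[OF jS(1) kS(1)] jk(8) le_M[OF jS(1)] le_M[OF kS(1)] S(4)[OF jS(1)] S(4)[OF kS(1)]
        by linarith+
      moreover have "\<not> elbow_adjacent (e k) (e j)" using jk(8) elbow_adjacent_sym[of "e k" "e j"] by blast
      ultimately show ?thesis
        using jk(3-8) jk(6,7)[THEN elbow_adjacent_sym] jS kS wlog[of j k] wlog[of k j] by blast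
    qed
    obtain j k where jk: "j \<in> S" "k \<in> S" "j \<noteq> i" "k \<noteq> i" "j \<noteq> k" "r j = M" "l k = M"
      "elbow_adjacent (e i) (e j)" "elbow_adjacent (e i) (e k)" "\<not> elbow_adjacent (e j) (e k)"
      using split_nbrs[OF i] by meson
    \<comment> \<open>Repeating the argument for \<open>k\<close> yields a second arm ending at
      \<open>M\<close>. Now \<open>i\<close> and \<open>k\<close> start at \<open>M\<close> while
      \<open>j\<close> and \<open>m\<close> end there, and \<open>i\<close>, \<open>j\<close>,
      \<open>m\<close>, \<open>k\<close> form the forbidden cycle of length four.\<close>
    obtain m where m: "m \<in> S" "m \<noteq> k" "r m = M" "elbow_adjacent (e k) (e m)"
      using split_nbrs[OF jk(2,7)] by meson
    have "m \<noteq> j" using m(4) jk(10) elbow_adjacent_sym[of "e k" "e j"] by blast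
    moreover have "m \<noteq> i" using m i S(4)[OF i(1)] by auto
    moreover have "elbow_adjacent (e m) (e j)"
      using adjI[OF m(1) jk(1)] S(4)[OF m(1)] S(4)[OF jk(1)] m(3) jk(6) by auto
    moreover have "elbow_adjacent (e m) (e k)" using m(4) by (rule elbow_adjacent_sym)
    moreover have "i \<in> R" "m \<in> R" "j \<in> R" "k \<in> R" "distinct [i, m, j, k]"
      using i jk m \<open>m \<noteq> j\<close> \<open>m \<noteq> i\<close> by (auto simp: S_def)
    ultimately show False
      using long_cycle_like_C4[OF R] jk(8-10) by blast
  qed
  moreover have "x \<in> S" "y \<in> S" using xy by (auto simp: S_def)
  ultimately have "l x < r y" "l y < r x" using S(2) by (meson le_less_trans)+
  with \<open>x \<in> S\<close> \<open>y \<in> S\<close> show ?thesis by (rule adjI)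
qed

lemma horizontal_neighbours_clique:
  fixes e :: "'i \<Rightarrow> real \<times> real \<times> real \<times> real"
  assumes R: "long_cycle_like R (\<lambda>i j. elbow_adjacent (e i) (e j))"
    and hub_adj: "\<And>i. i \<in> R \<Longrightarrow> elbow_adjacent h (e i)"
    and xy: "x \<in> R" "y \<in> R" "horizontal_overlap h (e x)" "horizontal_overlap h (e y)"
  shows "elbow_adjacent (e x) (e y)"
proof -
  obtain a0 b0 p0 q0 where h: "h = (a0, b0, p0, q0)" by (cases h)
  have "a0 \<noteq> p0" using xy(3) by (cases "e x") (auto simp: h ivl_overlap_def)
  then consider "a0 < p0" | "- a0 < - p0" by linarith
  then show ?thesis
  proof cases
    case 1
    show ?thesis
      by (rule horizontal_neighbours_clique_right[OF R h 1 hub_adj xy])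
  next
    case 2
    \<comment> \<open>Reflection in a vertical axis makes the horizontal arm of the hub point
      right.\<close>
    show ?thesis
      by (rule horizontal_neighbours_clique_right[where R = R and e = "\<lambda>i. reflect_elbow (e i)"
            and h = "reflect_elbow h" and ?a0.0 = "- a0" and ?b0.0 = b0 and ?p0.0 = "- p0" and ?q0.0 = q0,
            unfolded elbow_adjacent_reflect horizontal_overlap_reflect,
            OF R _ 2 hub_adj xy]) (simp_all add: h)
  qed
qed

text \<open>Agreement is asked only off the diagonal: an elbow with a non-degenerate arm overlaps
  itself, whereas the graph has no loops.\<close>

lemma long_cycle_like_cong:
  assumes "long_cycle_like R adj"
    and "\<And>i j. i \<in> R \<Longrightarrow> j \<in> R \<Longrightarrow> i \<noteq> j \<Longrightarrow> adj' i j = adj i j"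
  shows "long_cycle_like R adj'"
  unfolding long_cycle_like_def
proof (intro conjI ballI impI)
  show "finite R" using assms(1) by (simp add: long_cycle_like_def)
next
  fix i assume "i \<in> R"
  obtain j k where "j \<in> R" "k \<in> R" "j \<noteq> i" "k \<noteq> i" "j \<noteq> k" "adj i j" "adj i k" "\<not> adj j k"
    by (rule long_cycle_like_neighbours[OF assms(1) \<open>i \<in> R\<close>])
  then show "\<exists>j\<in>R. \<exists>k\<in>R. j \<noteq> i \<and> k \<noteq> i \<and> j \<noteq> k \<and> adj' i j \<and> adj' i k \<and> \<not> adj' j k"
    using \<open>i \<in> R\<close> assms(2) by metis
next
  fix i m j k
  assume "i \<in> R" "m \<in> R" "j \<in> R" "k \<in> R" "distinct [i, m, j, k]"
    and "adj' i j" "adj' i k" "adj' m j" "adj' m k"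
  then show "adj' j k"
    using long_cycle_like_C4[OF assms(1), of i m j k] assms(2) by auto
qed

section \<open>The cycle of length five as the rim of a wheel\<close>

abbreviation C5_edges :: "nat set set" where
  "C5_edges \<equiv> {{1, 2}, {2, 3}, {3, 4}, {4, 5}, {1, 5}}"

lemma C5_neighbours:
  assumes "{u, v} \<in> C5_edges"
  shows "u = 1 \<and> (v = 2 \<or> v = 5) \<or> u = 2 \<and> (v = 1 \<or> v = 3) \<or> u = 3 \<and> (v = 2 \<or> v = 4) \<or>
    u = 4 \<and> (v = 3 \<or> v = 5) \<or> u = 5 \<and> (v = 4 \<or> v = 1)"
  using assms by (auto simp: doubleton_eq_iff)

lemma C5_common_neighbour:
  assumes "{i, j} \<in> C5_edges" "{i, k} \<in> C5_edges" "j \<noteq> k"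
  shows "(i, j, k) \<in> {(1, 2, 5), (1, 5, 2), (2, 1, 3), (2, 3, 1), (3, 2, 4), (3, 4, 2),
    (4, 3, 5), (4, 5, 3), (5, 4, 1), (5, 1, 4)}"
  using C5_neighbours[OF assms(1)] C5_neighbours[OF assms(2)] assms(3)
  by (elim disjE conjE) simp_all

lemma C5_common_neighbour_unique:
  assumes "{i, j} \<in> C5_edges" "{i, k} \<in> C5_edges" "{m, j} \<in> C5_edges" "{m, k} \<in> C5_edges" "j \<noteq> k"
  shows "i = m"
  using C5_common_neighbour[OF assms(1,2,5)] C5_common_neighbour[OF assms(3,4,5)]
  unfolding insert_iff empty_iff prod.inject by (elim disjE conjE FalseE) simp_all

lemma long_cycle_like_C5: "long_cycle_like {1..5} (\<lambda>i j. {i, j} \<in> C5_edges)"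
  unfolding long_cycle_like_def
proof (intro conjI ballI impI)
  show "\<exists>j\<in>{1..5}. \<exists>k\<in>{1..5}. j \<noteq> i \<and> k \<noteq> i \<and> j \<noteq> k \<and>
      {i, j} \<in> C5_edges \<and> {i, k} \<in> C5_edges \<and> {j, k} \<notin> C5_edges" if "i \<in> {1..5}" for i
  proof -
    have "i = 1 \<or> i = 2 \<or> i = 3 \<or> i = 4 \<or> i = 5" using that by auto
    then show ?thesis
      apply (elim disjE)
      subgoal by (rule bexI[of _ 2], rule bexI[of _ 5]) (simp_all add: doubleton_eq_iff)
      subgoal by (rule bexI[of _ 1], rule bexI[of _ 3]) (simp_all add: doubleton_eq_iff)
      subgoal by (rule bexI[of _ 2], rule bexI[of _ 4]) (simp_all add: doubleton_eq_iff)
      subgoal by (rule bexI[of _ 3], rule bexI[of _ 5]) (simp_all add: doubleton_eq_iff)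
      subgoal by (rule bexI[of _ 4], rule bexI[of _ 1]) (simp_all add: doubleton_eq_iff)
      done
  qed
next
  fix i m j k
  assume "distinct [i, m, j, k]"
    and "{i, j} \<in> C5_edges" "{i, k} \<in> C5_edges" "{m, j} \<in> C5_edges" "{m, k} \<in> C5_edges"
  then have "i = m"
    by (intro C5_common_neighbour_unique[of i j k m]) simp_all
  with \<open>distinct [i, m, j, k]\<close> show "{j, k} \<in> C5_edges" by simp
qed simp

lemma no_elbow_wheel:
  fixes e :: "nat \<Rightarrow> real \<times> real \<times> real \<times> real"
  assumes hub: "\<And>i. i \<in> {1..5} \<Longrightarrow> elbow_adjacent (e 0) (e i)"
    and rim: "\<And>i j. i \<in> {1..5} \<Longrightarrow> j \<in> {1..5} \<Longrightarrow> i \<noteq> j \<Longrightarrow>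
      elbow_adjacent (e i) (e j) \<longleftrightarrow> {i, j} \<in> C5_edges"
  shows False
proof -
  have R: "long_cycle_like {1..5} (\<lambda>i j. elbow_adjacent (e i) (e j))"
    using long_cycle_like_C5 by (rule long_cycle_like_cong) (rule rim)
  have h: "elbow_adjacent (e x) (e y)"
    if "x \<in> {1..5}" "y \<in> {1..5}" "horizontal_overlap (e 0) (e x)" "horizontal_overlap (e 0) (e y)" for x y
    by (rule horizontal_neighbours_clique[OF R hub that])
  have v: "elbow_adjacent (e x) (e y)"
    if "x \<in> {1..5}" "y \<in> {1..5}" "vertical_overlap (e 0) (e x)" "vertical_overlap (e 0) (e y)" for x y
    by (rule horizontal_neighbours_clique[where R = "{1..5}" and e = "\<lambda>i. transpose_elbow (e i)"
          and h = "transpose_elbow (e 0)",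
          unfolded elbow_adjacent_transpose horizontal_overlap_transpose,
          OF R hub that])
  \<comment> \<open>The listed pairs are the non-edges of the rim, and they form a cycle of length
    five again. Choosing for each rim vertex an arm of the hub that it meets would properly colour
    this odd cycle with two colours.\<close>
  have excl: "\<not> (horizontal_overlap (e 0) (e x) \<and> horizontal_overlap (e 0) (e y))"
    "\<not> (vertical_overlap (e 0) (e x) \<and> vertical_overlap (e 0) (e y))"
    if "(x, y) \<in> {(1, 3), (3, 5), (5, 2), (2, 4), (4, 1)}" for x y
  proof -
    have "x \<in> {1..5}" "y \<in> {1..5}" "\<not> elbow_adjacent (e x) (e y)"
      using that by (auto simp: rim doubleton_eq_iff)
    then show "\<not> (horizontal_overlap (e 0) (e x) \<and> horizontal_overlap (e 0) (e y))"
      "\<not> (vertical_overlap (e 0) (e x) \<and> vertical_overlap (e 0) (e y))"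
      using h v by blast+
  qed
  have "horizontal_overlap (e 0) (e x) \<or> vertical_overlap (e 0) (e x)" if "x \<in> {1, 2, 3, 4, 5}" for x
    using hub[of x] that by (auto simp: elbow_adjacent_def)
  from this[of 1] this[of 2] this[of 3] this[of 4] this[of 5] show False
    using excl[of 1 3] excl[of 3 5] excl[of 5 2] excl[of 2 4] excl[of 4 1] by simp argo
qed

lemma bend_path_elbow:
  assumes "bend_path k g" "k \<le> 1"
  obtains s where "path_image g = (\<Union>x\<in>elbow_segments s. axis_segment x)"
proof -
  obtain ps where ps: "length ps = k + 2" "g = polyline ps"
    "\<forall>i\<le>k. horizontal (ps ! i) (ps ! (i + 1)) \<or> vertical (ps ! i) (ps ! (i + 1))"
    "\<forall>i<k. horizontal (ps ! i) (ps ! (i + 1)) \<longleftrightarrow> vertical (ps ! (i + 1)) (ps ! (i + 2))"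
    using assms(1) unfolding bend_path_def by blast
  consider (0) a b where "k = 0" "ps = [a, b]" | (1) a b c where "k = 1" "ps = [a, b, c]"
    using ps(1) assms(2) by (cases k) (auto simp: length_Suc_conv)
  then show thesis
  proof cases
    case 0
    have img: "path_image g = closed_segment a b" using ps(2) 0 by simp
    have "horizontal a b \<or> vertical a b" using ps(3) 0 by simp
    then show thesis
    proof
      assume "horizontal a b"
      then have "Im a = Im b" by (simp add: horizontal_def)
      \<comment> \<open>The vertical arm is degenerate and contributes only the corner
        \<open>a\<close>.\<close>
      have "closed_segment a b = (\<Union>x\<in>elbow_segments (Re a, Im a, Re b, Im a). axis_segment x)"
        unfolding closed_segment_horizontal[OF \<open>Im a = Im b\<close>] by auto
      then show thesis using that img by metis
    next
      assume "vertical a b"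
      then have "Re a = Re b" by (simp add: vertical_def)
      have "closed_segment a b = (\<Union>x\<in>elbow_segments (Re a, Im a, Re a, Im b). axis_segment x)"
        unfolding closed_segment_vertical[OF \<open>Re a = Re b\<close>] by auto
      then show thesis using that img by metis
    qed
  next
    case 1
    have img: "path_image g = closed_segment a b \<union> closed_segment b c"
      using ps(2) 1 by (simp add: path_image_join)
    have hv: "horizontal a b \<or> vertical a b" "horizontal b c \<or> vertical b c"
      "horizontal a b \<longleftrightarrow> vertical b c"
      using ps(3)[rule_format, of 0] ps(3)[rule_format, of 1] ps(4)[rule_format, of 0] 1
      by (simp_all add: numeral_2_eq_2)
    then consider "horizontal a b" "vertical b c" | "vertical a b" "horizontal b c" by blast
    then show thesis
    proof cases
      case 1
      then have "Im a = Im b" "Re b = Re c" by (simp_all add: horizontal_def vertical_def)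
      have "closed_segment a b \<union> closed_segment b c =
          (\<Union>x\<in>elbow_segments (Re b, Im b, Re a, Im c). axis_segment x)"
        unfolding closed_segment_horizontal[OF \<open>Im a = Im b\<close>] closed_segment_vertical[OF \<open>Re b = Re c\<close>]
        using \<open>Im a = Im b\<close> by (simp add: min.commute max.commute)
      then show thesis using that img by metis
    next
      case 2
      then have "Re a = Re b" "Im b = Im c" by (simp_all add: horizontal_def vertical_def)
      have "closed_segment a b \<union> closed_segment b c =
          (\<Union>x\<in>elbow_segments (Re b, Im b, Re c, Im a). axis_segment x)"
        unfolding closed_segment_vertical[OF \<open>Re a = Re b\<close>] closed_segment_horizontal[OF \<open>Im b = Im c\<close>]
        using \<open>Re a = Re b\<close> by (simp add: min.commute max.commute Un_commute)
      then show thesis using that img by metis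
    qed
  qed
qed

abbreviation W5_spokes :: "nat set set" where
  "W5_spokes \<equiv> (\<lambda>i. {0, i}) ` {1..5}"

lemma W5_no_EPG:
  assumes "k \<le> 1"
  shows "\<not> EPG_representation k {0..5} (W5_spokes \<union> C5_edges) P"
proof
  assume rep: "EPG_representation k {0..5} (W5_spokes \<union> C5_edges) P"
  have "\<exists>s. path_image (P u) = (\<Union>x\<in>elbow_segments s. axis_segment x)" if "u \<in> {0..5}" for u
    using bend_path_elbow[of k "P u"] rep assms that unfolding EPG_representation_def by metis
  then obtain e where e: "\<And>u. u \<in> {0..5} \<Longrightarrow> path_image (P u) = (\<Union>x\<in>elbow_segments (e u). axis_segment x)"
    by metis
  have fin: "finite (elbow_segments s)" for s by (cases s) simp
  have adj: "elbow_adjacent (e u) (e v) \<longleftrightarrow> {u, v} \<in> W5_spokes \<union> C5_edges"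
    if "u \<in> {0..5}" "v \<in> {0..5}" "u \<noteq> v" for u v
    using share_segment_iff_overlap[OF fin fin e[OF that(1)] e[OF that(2)]] rep that
    unfolding EPG_representation_def elbow_adjacent_iff_overlap by metis
  show False
  proof (rule no_elbow_wheel[of e])
    fix i :: nat assume "i \<in> {1..5}"
    then show "elbow_adjacent (e 0) (e i)" by (subst adj) auto
  next
    fix i j :: nat assume ij: "i \<in> {1..5}" "j \<in> {1..5}" "i \<noteq> j"
    have "{i, j} \<notin> W5_spokes" using ij by (auto simp: doubleton_eq_iff)
    then show "elbow_adjacent (e i) (e j) \<longleftrightarrow> {i, j} \<in> C5_edges"
      using adj[of i j] ij by simp
  qed
qed

section \<open>The wheel with five spokes is a Halin graph\<close>

lemma cycle_graph_C5: "cycle_graph {1..5} C5_edges"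
  unfolding cycle_graph_def
proof (intro exI[of _ "[1, 2, 3, 4, 5]"] conjI)
  have "{..<length [1, 2, 3, 4, 5 :: nat]} = {0, 1, 2, 3, 4}" by auto
  then show "C5_edges = {{[1, 2, 3, 4, 5] ! i, [1, 2, 3, 4, 5] ! (Suc i mod length [1, 2, 3, 4, 5 :: nat])} |i. i < length [1, 2, 3, 4, 5 :: nat]}"
    unfolding lessThan_iff[symmetric] Setcompr_eq_image Collect_mem_eq by (simp add: insert_commute)
qed auto

text \<open>Every edge of a star contains the centre, but no vertex of a cycle lies on three of its
  edges. Three consecutive edges already give the contradiction, also when the cycle has length
  three and the third edge returns to position \<open>0\<close>.\<close>

lemma acyclic_star: "acyclic_graph ((\<lambda>i. {c, i}) ` L)"
  unfolding acyclic_graph_def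
proof (intro notI, elim exE conjE)
  fix W F assume F: "F \<subseteq> (\<lambda>i. {c, i}) ` L" and "cycle_graph W F"
  then obtain vs where vs: "distinct vs" "length vs \<ge> 3"
    "F = {{vs ! i, vs ! (Suc i mod length vs)} |i. i < length vs}"
    unfolding cycle_graph_def by blast
  have c: "vs ! i = c \<or> vs ! (Suc i mod length vs) = c" if "i < length vs" for i
  proof -
    have "{vs ! i, vs ! (Suc i mod length vs)} \<in> (\<lambda>i. {c, i}) ` L"
      using F that unfolding vs(3) by blast
    then show ?thesis by (auto simp: doubleton_eq_iff)
  qed
  have eq: "i = j" if "vs ! i = c" "vs ! j = c" "i < length vs" "j < length vs" for i j
    using that vs(1) nth_eq_iff_index_eq by metis
  have "Suc 0 mod length vs = 1" "Suc 1 mod length vs = 2" "Suc 2 mod length vs \<noteq> 1"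
    using vs(2) by (cases "length vs = 3"; simp)+
  moreover have "0 < length vs" "1 < length vs" "2 < length vs" "Suc 2 mod length vs < length vs"
    using vs(2) by (auto intro: mod_less_divisor)
  ultimately show False
    using c[of 0] c[of 1] c[of 2] eq[of 0 2] eq[of 1 2] eq[of "Suc 2 mod length vs" 1] by metis
qed

lemma tree_graph_star:
  assumes "finite L" "c \<notin> L"
  shows "tree_graph (insert c L) ((\<lambda>i. {c, i}) ` L)"
proof -
  let ?R = "{(x, y). {x, y} \<in> (\<lambda>i. {c, i}) ` L}"
  have to_c: "(u, c) \<in> ?R\<^sup>*" and from_c: "(c, u) \<in> ?R\<^sup>*" if "u \<in> insert c L" for u
    using that by (cases "u = c"; auto simp: insert_commute intro!: r_into_rtrancl)+
  have "(u, v) \<in> ?R\<^sup>*" if "u \<in> insert c L" "v \<in> insert c L" for u v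
    using to_c[OF that(1)] from_c[OF that(2)] by (rule rtrancl_trans)
  then have "connected_graph (insert c L) ((\<lambda>i. {c, i}) ` L)"
    unfolding connected_graph_def by blast
  moreover have "simple_graph (insert c L) ((\<lambda>i. {c, i}) ` L)"
    using assms by (auto simp: simple_graph_def card_insert_if)
  ultimately show ?thesis
    by (simp add: tree_graph_def acyclic_star)
qed

text \<open>The centre has degree \<open>card L\<close>; for \<open>card L = 1\<close> it would be a
  leaf as well.\<close>

lemma leaves_star:
  assumes "finite L" "c \<notin> L" "card L \<noteq> 1"
  shows "leaves (insert c L) ((\<lambda>i. {c, i}) ` L) = L"
proof -
  have "{e \<in> (\<lambda>i. {c, i}) ` L. c \<in> e} = (\<lambda>i. {c, i}) ` L" by auto
  moreover have "inj_on (\<lambda>i. {c, i}) L" by (auto simp: inj_on_def doubleton_eq_iff)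
  ultimately have "vertex_degree ((\<lambda>i. {c, i}) ` L) c \<noteq> 1"
    using assms(3) by (simp add: vertex_degree_def card_image)
  moreover have "vertex_degree ((\<lambda>i. {c, i}) ` L) v = 1" if "v \<in> L" for v
  proof -
    have "{e \<in> (\<lambda>i. {c, i}) ` L. v \<in> e} = {{c, v}}" using that assms(2) by auto
    then show ?thesis by (simp add: vertex_degree_def)
  qed
  ultimately show ?thesis by (auto simp: leaves_def)
qed

text \<open>The hub is the origin, inside a convex pentagon whose corners have small integer
  coordinates.\<close>

definition W5_pos :: "nat \<Rightarrow> complex" where
  "W5_pos i = [Complex 0 0, Complex 0 2, Complex (- 2) 1, Complex (- 1) (- 2), Complex 1 (- 2), Complex 2 1] ! i"

lemma W5_pos_simps:
  "W5_pos 0 = Complex 0 0" "W5_pos (Suc 0) = Complex 0 2" "W5_pos 2 = Complex (- 2) 1"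
  "W5_pos 3 = Complex (- 1) (- 2)" "W5_pos 4 = Complex 1 (- 2)" "W5_pos 5 = Complex 2 1"
  by (simp_all add: W5_pos_def)

lemma W5_pos_cases:
  assumes "i \<in> {0..5}"
  obtains "i = 0" | "i = Suc 0" | "i = 2" | "i = 3" | "i = 4" | "i = 5"
  using assms by fastforce

text \<open>Each edge is listed once, smaller endpoint first, which fixes the direction of its
  straight arc.\<close>

definition W5_pairs :: "(nat \<times> nat) set" where
  "W5_pairs = {(Suc 0, 2), (2, 3), (3, 4), (4, 5), (Suc 0, 5), (0, Suc 0), (0, 2), (0, 3), (0, 4), (0, 5)}"

lemma closed_segment_Complex:
  assumes "z \<in> closed_segment (Complex a b) (Complex c d)"
  obtains t where "0 \<le> t" "t \<le> 1" "Re z = a + t * (c - a)" "Im z = b + t * (d - b)"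
proof -
  obtain t where "0 \<le> t" "t \<le> 1" "z = (1 - t) *\<^sub>R Complex a b + t *\<^sub>R Complex c d"
    using assms unfolding in_segment by blast
  then have "0 \<le> t" "t \<le> 1" "Re z = (1 - t) * a + t * c" "Im z = (1 - t) * b + t * d" by simp_all
  then show thesis by (intro that[of t]) (simp_all add: algebra_simps)
qed

lemma W5_segments_meet:
  assumes "(u, v) \<in> W5_pairs" "(u', v') \<in> W5_pairs" "(u, v) \<noteq> (u', v')"
    and "z \<in> closed_segment (W5_pos u) (W5_pos v)" "z \<in> closed_segment (W5_pos u') (W5_pos v')"
  shows "z \<in> W5_pos ` ({u, v} \<inter> {u', v'})"
proof -
  obtain t where t: "0 \<le> t" "t \<le> 1" "Re z = Re (W5_pos u) + t * (Re (W5_pos v) - Re (W5_pos u))"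
    "Im z = Im (W5_pos u) + t * (Im (W5_pos v) - Im (W5_pos u))"
    using assms(4) closed_segment_Complex[of z] by (metis complex_surj)
  obtain s where s: "0 \<le> s" "s \<le> 1" "Re z = Re (W5_pos u') + s * (Re (W5_pos v') - Re (W5_pos u'))"
    "Im z = Im (W5_pos u') + s * (Im (W5_pos v') - Im (W5_pos u'))"
    using assms(5) closed_segment_Complex[of z] by (metis complex_surj)
  \<comment> \<open>With the positions substituted, each pair of edges gives a linear system in the
    two parameters \<open>t\<close> and \<open>s\<close>: it is either unsolvable or solved only at
    the common endpoint.\<close>
  show ?thesis
    using assms(1-3) unfolding W5_pairs_def insert_iff empty_iff prod.inject
    by (elim disjE conjE FalseE; hypsubst; use s t in \<open>simp add: W5_pos_simps complex_eq_iff\<close>; linarith?)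
qed

lemma W5_edges_pairs:
  assumes "e \<in> W5_spokes \<union> C5_edges"
  obtains u v where "(u, v) \<in> W5_pairs" "u < v" "v \<le> 5" "e = {u, v}"
proof -
  have "{1..5::nat} = {1, 2, 3, 4, 5}" by auto
  then have "(\<lambda>(u, v). {u, v}) ` W5_pairs = W5_spokes \<union> C5_edges"
    by (simp add: W5_pairs_def)
  with assms have "e \<in> (\<lambda>(u, v). {u, v}) ` W5_pairs" by simp
  then obtain u v where uv: "(u, v) \<in> W5_pairs" "e = {u, v}" by auto
  then have "u < v" "v \<le> 5" by (auto simp: W5_pairs_def)
  with uv show thesis by (intro that)
qed

lemma W5_pos_inj: "inj_on W5_pos {0..5}"
  by (rule inj_onI) (elim W5_pos_cases; simp add: W5_pos_simps)

lemma W5_planar: "planar_graph {0..5} (W5_spokes \<union> C5_edges)"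
  unfolding planar_graph_def
proof (intro exI)
  \<comment> \<open>An edge is an unordered pair; \<open>Min\<close> and \<open>Max\<close> choose
    the start and the end of its arc.\<close>
  define \<gamma> where "\<gamma> e = linepath (W5_pos (Min e)) (W5_pos (Max e))" for e
  have \<gamma>: "\<gamma> {u, v} = linepath (W5_pos u) (W5_pos v)" if "u < v" for u v
    using that by (simp add: \<gamma>_def)
  have meet: "path_image (\<gamma> e) \<inter> path_image (\<gamma> f) \<subseteq> W5_pos ` (e \<inter> f)"
    if ef: "e \<in> W5_spokes \<union> C5_edges" "f \<in> W5_spokes \<union> C5_edges" "e \<noteq> f" for e f
  proof -
    obtain u v where e: "(u, v) \<in> W5_pairs" "u < v" "v \<le> 5" "e = {u, v}"
      using ef(1) by (rule W5_edges_pairs)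
    obtain u' v' where f: "(u', v') \<in> W5_pairs" "u' < v'" "v' \<le> 5" "f = {u', v'}"
      using ef(2) by (rule W5_edges_pairs)
    have "(u, v) \<noteq> (u', v')" using e f that(3) by auto
    then show ?thesis
      using W5_segments_meet[OF e(1) f(1)] unfolding e(4) f(4) \<gamma>[OF e(2)] \<gamma>[OF f(2)] by auto
  qed
  show "plane_drawing {0..5} (W5_spokes \<union> C5_edges) W5_pos \<gamma>"
    unfolding plane_drawing_def
  proof (intro conjI ballI impI)
    show "inj_on W5_pos {0..5}" by (rule W5_pos_inj)
  next
    fix e assume e: "e \<in> W5_spokes \<union> C5_edges"
    obtain u v where uv: "(u, v) \<in> W5_pairs" "u < v" "v \<le> 5" "e = {u, v}"
      using e by (rule W5_edges_pairs)
    have "W5_pos u \<noteq> W5_pos v"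
      using uv inj_onD[OF W5_pos_inj, of u v] by auto
    then show "arc (\<gamma> e)" by (simp add: uv(4) \<gamma>[OF uv(2)] arc_linepath)
    show ends: "{pathstart (\<gamma> e), pathfinish (\<gamma> e)} = W5_pos ` e"
      by (simp add: uv(4) \<gamma>[OF uv(2)])
    have "w \<in> e" if "w \<in> {0..5}" "W5_pos w \<in> path_image (\<gamma> e)" for w
    proof (rule ccontr)
      assume "w \<notin> e"
      \<comment> \<open>That an arc avoids foreign vertices follows from the way arcs meet:
        \<open>f\<close> is a spoke through \<open>w\<close>, for the hub the one to vertex
        \<open>1\<close>, so \<open>w\<close> would be a common point of two arcs and hence an
        endpoint of both.\<close>
      define f where "f = {0, if w = 0 then 1 else w}"
      have f: "f \<in> W5_spokes \<union> C5_edges" "w \<in> f" "f \<noteq> e"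
        using \<open>w \<notin> e\<close> \<open>w \<in> {0..5}\<close> by (auto simp: f_def)
      obtain u' v' where "u' < v'" "f = {u', v'}" using f(1) by (rule W5_edges_pairs)
      then have "W5_pos w \<in> path_image (\<gamma> f)" using f(2) by (auto simp: \<gamma>)
      then have "W5_pos w \<in> W5_pos ` (e \<inter> f)" using meet[OF e f(1)] f(3) that(2) by blast
      then obtain w' where "w' \<in> e" "W5_pos w' = W5_pos w" by auto
      moreover have "w' \<in> {0..5}" using \<open>w' \<in> e\<close> uv by auto
      ultimately show False using inj_onD[OF W5_pos_inj] that(1) \<open>w \<notin> e\<close> by metis
    qed
    moreover have "W5_pos ` e \<subseteq> path_image (\<gamma> e)" "e \<subseteq> {0..5}"
      using uv by (auto simp: \<gamma>)
    ultimately show "path_image (\<gamma> e) \<inter> W5_pos ` {0..5} = W5_pos ` e" by blast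
  qed (rule meet)
qed

lemma three_le_vertex_degree:
  assumes "finite E" "{a, b, c} \<subseteq> {e \<in> E. v \<in> e}" "distinct [a, b, c]"
  shows "vertex_degree E v \<ge> 3"
proof -
  have "card {a, b, c} = 3" using assms(3) by simp
  moreover have "card {a, b, c} \<le> card {e \<in> E. v \<in> e}"
    using assms(1,2) by (intro card_mono) auto
  ultimately show ?thesis by (simp add: vertex_degree_def)
qed

lemma halin_W5: "halin_graph {0..5} (W5_spokes \<union> C5_edges)"
proof -
  have V: "{0..5::nat} = insert 0 {1..5}" by auto
  have "vertex_degree (W5_spokes \<union> C5_edges) v \<noteq> 2" if "v \<in> {0..5}" for v
  proof -
    have "3 \<le> vertex_degree (W5_spokes \<union> C5_edges) v"
      using that
    proof (cases v rule: W5_pos_cases)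
      case 1
      then show ?thesis
        by (intro three_le_vertex_degree[of _ "{0, 1}" "{0, 2}" "{0, 3}"]) (auto simp: doubleton_eq_iff)
    next
      case 2
      then show ?thesis
        by (intro three_le_vertex_degree[of _ "{0, 1}" "{1, 2}" "{1, 5}"]) (auto simp: doubleton_eq_iff)
    next
      case 3
      then show ?thesis
        by (intro three_le_vertex_degree[of _ "{0, 2}" "{1, 2}" "{2, 3}"]) (auto simp: doubleton_eq_iff)
    next
      case 4
      then show ?thesis
        by (intro three_le_vertex_degree[of _ "{0, 3}" "{2, 3}" "{3, 4}"]) (auto simp: doubleton_eq_iff)
    next
      case 5
      then show ?thesis
        by (intro three_le_vertex_degree[of _ "{0, 4}" "{3, 4}" "{4, 5}"]) (auto simp: doubleton_eq_iff)
    next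
      case 6
      then show ?thesis
        by (intro three_le_vertex_degree[of _ "{0, 5}" "{4, 5}" "{1, 5}"]) (auto simp: doubleton_eq_iff)
    qed
    then show ?thesis by simp
  qed
  moreover have "simple_graph {0..5} (W5_spokes \<union> C5_edges)"
    by (auto simp: simple_graph_def)
  moreover have "tree_graph {0..5} W5_spokes"
    unfolding V by (rule tree_graph_star) auto
  moreover have "cycle_graph (leaves {0..5} W5_spokes) C5_edges"
    unfolding V by (subst leaves_star) (simp_all only: cycle_graph_C5, simp_all)
  ultimately show ?thesis
    using W5_planar unfolding halin_graph_def by blast
qed

section \<open>Rooted trees\<close>

lemma rtrancl_distinct_walk:
  assumes "(u, v) \<in> R\<^sup>*"
  obtains xs where "distinct xs" "xs \<noteq> []" "hd xs = u" "last xs = v" "successively (\<lambda>x y. (x, y) \<in> R) xs"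
proof -
  from assms have "\<exists>xs. distinct xs \<and> xs \<noteq> [] \<and> hd xs = u \<and> last xs = v \<and> successively (\<lambda>x y. (x, y) \<in> R) xs"
  proof (induction rule: rtrancl_induct)
    case base
    show ?case by (rule exI[of _ "[u]"]) simp
  next
    case (step y z)
    then obtain xs where xs: "distinct xs" "xs \<noteq> []" "hd xs = u" "last xs = y"
      "successively (\<lambda>x y. (x, y) \<in> R) xs" by blast
    show ?case
    proof (cases "z \<in> set xs")
      case True
      then obtain ys zs where eq: "xs = ys @ z # zs" by (meson split_list)
      then have "successively (\<lambda>x y. (x, y) \<in> R) (ys @ [z])"
        using xs(5) unfolding eq by (auto simp: successively_append_iff)
      moreover have "hd (ys @ [z]) = u" using xs(3) eq by (cases ys) auto
      ultimately show ?thesis using xs(1) eq by (intro exI[of _ "ys @ [z]"]) simp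
    next
      case False
      then show ?thesis using xs step.hyps(2)
        by (intro exI[of _ "xs @ [z]"]) (simp add: successively_append_iff)
    qed
  qed
  then show thesis using that by blast
qed

text \<open>With its loops cut out, the walk visits distinct vertices. As \<open>{u, v}\<close> is
  not in \<open>F\<close>, at least one vertex lies strictly between the ends, so the new edge
  closes a cycle of length at least three.\<close>

lemma cycle_of_walk_and_edge:
  assumes "(u, v) \<in> {(x, y). {x, y} \<in> F}\<^sup>*" "u \<noteq> v" "{u, v} \<notin> F"
  shows "\<exists>W F'. F' \<subseteq> insert {u, v} F \<and> cycle_graph W F'"
proof -
  obtain xs where xs: "distinct xs" "xs \<noteq> []" "hd xs = u" "last xs = v"
    "successively (\<lambda>x y. (x, y) \<in> {(x, y). {x, y} \<in> F}) xs"
    using assms(1) by (rule rtrancl_distinct_walk)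
  have "length xs \<noteq> 1"
    using xs(2-4) assms(2) by (auto simp: length_Suc_conv)
  moreover have "length xs \<noteq> 2"
    using xs(3-5) assms(3) by (auto simp: length_Suc_conv numeral_2_eq_2)
  ultimately have len: "length xs \<ge> 3"
    using xs(2) length_0_conv[of xs] by linarith
  have "{xs ! i, xs ! (Suc i mod length xs)} \<in> insert {u, v} F" if "i < length xs" for i
  proof (cases "Suc i < length xs")
    case True
    then show ?thesis using xs(5) by (simp add: successively_conv_nth)
  next
    case False
    with that have i: "Suc i = length xs" by simp
    then have "xs ! i = v" using xs(2,4) by (metis diff_Suc_1 last_conv_nth)
    moreover have "xs ! 0 = u" using xs(2,3) by (simp add: hd_conv_nth)
    ultimately show ?thesis by (simp add: i insert_commute)
  qed
  then have "{{xs ! i, xs ! (Suc i mod length xs)} |i. i < length xs} \<subseteq> insert {u, v} F"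
    by blast
  moreover have "cycle_graph (set xs) {{xs ! i, xs ! (Suc i mod length xs)} |i. i < length xs}"
    unfolding cycle_graph_def using xs(1) len by blast
  ultimately show ?thesis by blast
qed

lemma connected_graph_crossing_edge:
  assumes "connected_graph V T" "S \<subseteq> V" "S \<noteq> V" "r \<in> S"
  obtains x y where "x \<in> S" "y \<notin> S" "{x, y} \<in> T"
proof -
  obtain z where z: "z \<in> V" "z \<notin> S" using assms(2,3) by blast
  have "(r, z) \<in> {(x, y). {x, y} \<in> T}\<^sup>*"
    using assms z unfolding connected_graph_def by blast
  then have "z \<notin> S \<Longrightarrow> \<exists>x y. x \<in> S \<and> y \<notin> S \<and> {x, y} \<in> T"
  proof (induction rule: rtrancl_induct)
    case base
    then show ?case using assms(4) by simp
  next
    case (step y z)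
    then show ?case by (cases "y \<in> S") auto
  qed
  then show thesis using that z by blast
qed

text \<open>The tree is grown from \<open>r\<close>, one crossing edge at a time: \<open>num\<close>
  is the order of discovery and \<open>par v\<close> the vertex from which \<open>v\<close> was
  discovered. The edges to parents already connect all vertices, so any further edge of
  \<open>T\<close> would close a cycle.\<close>

lemma tree_graph_parents:
  assumes T: "tree_graph V T" and r: "r \<in> V"
  obtains num :: "'a \<Rightarrow> nat" and par where "inj_on num V" "\<forall>v\<in>V. num v < card V"
    "\<forall>v\<in>V - {r}. par v \<in> V \<and> num (par v) < num v" "T = (\<lambda>v. {v, par v}) ` (V - {r})"
proof -
  have conn: "connected_graph V T" and acyc: "acyclic_graph T" and fin: "finite V"
    and T2: "\<And>e. e \<in> T \<Longrightarrow> e \<subseteq> V \<and> card e = 2"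
    using T by (auto simp: tree_graph_def simple_graph_def)
  have grow: "\<exists>S (num :: 'a \<Rightarrow> nat) par. r \<in> S \<and> S \<subseteq> V \<and> card S = Suc m \<and> inj_on num S \<and> (\<forall>v\<in>S. num v < Suc m) \<and>
      (\<forall>v\<in>S - {r}. par v \<in> S \<and> num (par v) < num v \<and> {v, par v} \<in> T)" if "Suc m \<le> card V" for m
    using that
  proof (induction m)
    case 0
    show ?case using r by (intro exI[of _ "{r}"] exI[of _ "\<lambda>_. 0"]) auto
  next
    case (Suc m)
    obtain S and num :: "'a \<Rightarrow> nat" and par where S: "r \<in> S" "S \<subseteq> V" "card S = Suc m" "inj_on num S"
      "\<forall>v\<in>S. num v < Suc m" "\<forall>v\<in>S - {r}. par v \<in> S \<and> num (par v) < num v \<and> {v, par v} \<in> T"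
      using Suc.IH[OF Suc_leD[OF Suc.prems]] by meson
    have "S \<noteq> V" using S(3) Suc.prems by auto
    obtain x y where xy: "x \<in> S" "y \<notin> S" "{x, y} \<in> T"
      using connected_graph_crossing_edge[OF conn S(2) \<open>S \<noteq> V\<close> S(1)] by blast
    let ?num = "num(y := Suc m)" and ?par = "par(y := x)"
    have "y \<in> V" using T2[OF xy(3)] by simp
    have "finite S" using S(2) fin by (rule finite_subset)
    have "card (insert y S) = Suc (Suc m)" using S(3) xy(2) \<open>finite S\<close> by simp
    moreover have "inj_on ?num (insert y S)"
    proof (rule inj_onI)
      fix a b assume "a \<in> insert y S" "b \<in> insert y S" "?num a = ?num b"
      then show "a = b"
        using S(5)[rule_format, of a] S(5)[rule_format, of b] inj_onD[OF S(4), of a b]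
        by (cases "a = y"; cases "b = y") auto
    qed
    moreover have "\<forall>v\<in>insert y S. ?num v < Suc (Suc m)" using S(5) by auto
    moreover have "\<forall>v\<in>insert y S - {r}. ?par v \<in> insert y S \<and> ?num (?par v) < ?num v \<and> {v, ?par v} \<in> T"
    proof
      fix v assume v: "v \<in> insert y S - {r}"
      show "?par v \<in> insert y S \<and> ?num (?par v) < ?num v \<and> {v, ?par v} \<in> T"
      proof (cases "v = y")
        case True
        then show ?thesis using xy S(5) by (auto simp: insert_commute)
      next
        case False
        then have "v \<in> S - {r}" using v by simp
        then show ?thesis using S(6) False xy(2) by auto
      qed
    qed
    moreover have "r \<in> insert y S" "insert y S \<subseteq> V" using S(1,2) \<open>y \<in> V\<close> by simp_all
    ultimately show ?case
      by (intro exI[of _ "insert y S"] exI[of _ ?num] exI[of _ ?par] conjI) assumption+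
  qed
  have "0 < card V" using r fin by (auto simp: card_gt_0_iff)
  then obtain m where m: "card V = Suc m" using gr0_implies_Suc by blast
  obtain S and num :: "'a \<Rightarrow> nat" and par where S: "S \<subseteq> V" "card S = card V" "inj_on num S"
      "\<forall>v\<in>S. num v < card V" "\<forall>v\<in>S - {r}. par v \<in> S \<and> num (par v) < num v \<and> {v, par v} \<in> T"
    using grow[of m] unfolding m by blast
  have "S = V" using card_subset_eq[OF fin S(1,2)] .
  note S = S[unfolded this]
  let ?F = "(\<lambda>v. {v, par v}) ` (V - {r})"
  let ?R = "{(x, y). {x, y} \<in> ?F}"
  have F_sub: "?F \<subseteq> T" using S(5) by (intro image_subsetI) simp
  have "sym ?R" by (auto simp: sym_def insert_commute)
  have to_r: "(v, r) \<in> ?R\<^sup>*" if "v \<in> V" for v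
    using that
  proof (induction "num v" arbitrary: v rule: less_induct)
    case less
    show ?case
    proof (cases "v = r")
      case False
      then have "par v \<in> V" "num (par v) < num v" using S(5) less.prems by auto
      then have "(par v, r) \<in> ?R\<^sup>*" by (intro less.hyps)
      moreover have "(v, par v) \<in> ?R" using False less.prems by auto
      ultimately show ?thesis by (rule converse_rtrancl_into_rtrancl[rotated])
    qed simp
  qed
  have "e \<in> ?F" if eT: "e \<in> T" for e
  proof (rule ccontr)
    assume "e \<notin> ?F"
    obtain u v where uv: "e = {u, v}" "u \<noteq> v" "u \<in> V" "v \<in> V"
      using T2[OF eT] by (auto simp: card_2_iff)
    have "(r, v) \<in> ?R\<^sup>*"
      using to_r[OF uv(4)] sym_rtrancl[OF \<open>sym ?R\<close>] by (auto dest: symD)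
    with to_r[OF uv(3)] have walk: "(u, v) \<in> ?R\<^sup>*" by (rule rtrancl_trans)
    have "{u, v} \<notin> ?F" using \<open>e \<notin> ?F\<close> uv(1) by simp
    then obtain W F' where "F' \<subseteq> insert {u, v} ?F" "cycle_graph W F'"
      using cycle_of_walk_and_edge[OF walk uv(2) \<open>{u, v} \<notin> ?F\<close>] by (elim exE conjE)
    moreover have "insert {u, v} ?F \<subseteq> T" using eT uv(1) F_sub by simp
    ultimately show False using acyc unfolding acyclic_graph_def by (meson order_trans)
  qed
  with F_sub have T_eq: "T = ?F" by (intro equalityI subsetI) auto
  show thesis
  proof (rule that[of num par])
    show "inj_on num V" "T = ?F" by fact+
    show "\<forall>v\<in>V. num v < card V" by fact
    show "\<forall>v\<in>V - {r}. par v \<in> V \<and> num (par v) < num v" using S(5) by simp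
  qed
qed

section \<open>Two-bend representations of trees with a leaf cycle\<close>

text \<open>Consecutive segments lie on perpendicular lines, which meet only in the bend, and the
  outer two lie in different rows. So the path is simple whichever way its horizontal segments
  point.\<close>

lemma bend_path_hvh:
  assumes "x0 \<noteq> x1" "y0 \<noteq> y1" "x1 \<noteq> x2"
  obtains g where "bend_path 2 g" "path_image g = (\<Union>s\<in>{(True, y0, min x0 x1, max x0 x1),
    (False, x1, min y0 y1, max y0 y1), (True, y1, min x1 x2, max x1 x2)}. axis_segment s)"
proof
  let ?a = "Complex x0 y0" and ?b = "Complex x1 y0" and ?c = "Complex x1 y1" and ?d = "Complex x2 y1"
  let ?g = "polyline [?a, ?b, ?c, ?d]"
  have seg: "closed_segment ?a ?b = axis_segment (True, y0, min x0 x1, max x0 x1)"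
    "closed_segment ?b ?c = axis_segment (False, x1, min y0 y1, max y0 y1)"
    "closed_segment ?c ?d = axis_segment (True, y1, min x1 x2, max x1 x2)"
    by (simp_all only: closed_segment_horizontal closed_segment_vertical complex.sel)
  have on_seg: "z \<in> closed_segment ?a ?b \<Longrightarrow> Im z = y0" "z \<in> closed_segment ?b ?c \<Longrightarrow> Re z = x1"
    "z \<in> closed_segment ?c ?d \<Longrightarrow> Im z = y1" for z
    unfolding seg by simp_all
  have img: "path_image (linepath ?b ?c +++ linepath ?c ?d) = closed_segment ?b ?c \<union> closed_segment ?c ?d"
    by (simp add: path_image_join)
  have "arc (linepath ?b ?c +++ linepath ?c ?d)"
  proof (rule arc_join)
    show "path_image (linepath ?b ?c) \<inter> path_image (linepath ?c ?d) \<subseteq> {pathstart (linepath ?c ?d)}"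
    proof
      fix z assume "z \<in> path_image (linepath ?b ?c) \<inter> path_image (linepath ?c ?d)"
      then show "z \<in> {pathstart (linepath ?c ?d)}" using on_seg[of z] by (simp add: complex_eq_iff)
    qed
  qed (use assms in \<open>simp_all add: arc_linepath\<close>)
  then have "arc (linepath ?a ?b +++ (linepath ?b ?c +++ linepath ?c ?d))"
  proof (rule arc_join[rotated])
    show "path_image (linepath ?a ?b) \<inter> path_image (linepath ?b ?c +++ linepath ?c ?d)
      \<subseteq> {pathstart (linepath ?b ?c +++ linepath ?c ?d)}"
    proof
      fix z assume "z \<in> path_image (linepath ?a ?b) \<inter> path_image (linepath ?b ?c +++ linepath ?c ?d)"
      then have "z \<in> closed_segment ?a ?b" "z \<in> closed_segment ?b ?c \<or> z \<in> closed_segment ?c ?d"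
        unfolding img by simp_all
      then show "z \<in> {pathstart (linepath ?b ?c +++ linepath ?c ?d)}"
        using on_seg[of z] assms(2) by (simp add: complex_eq_iff) argo
    qed
  qed (use assms in \<open>simp_all add: arc_linepath\<close>)
  then have "arc ?g" by simp
  moreover have "\<forall>i\<le>2. horizontal ([?a, ?b, ?c, ?d] ! i) ([?a, ?b, ?c, ?d] ! (i + 1)) \<or>
      vertical ([?a, ?b, ?c, ?d] ! i) ([?a, ?b, ?c, ?d] ! (i + 1))"
    "\<forall>i<2. horizontal ([?a, ?b, ?c, ?d] ! i) ([?a, ?b, ?c, ?d] ! (i + 1)) \<longleftrightarrow>
      vertical ([?a, ?b, ?c, ?d] ! (i + 1)) ([?a, ?b, ?c, ?d] ! (i + 2))"
    using assms by (simp_all add: numeral_2_eq_2 le_Suc_eq less_Suc_eq horizontal_def vertical_def all_conj_distrib)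
  ultimately show "bend_path 2 ?g"
    unfolding bend_path_def
    by (intro conjI arc_imp_simple_path exI[of _ "[?a, ?b, ?c, ?d]"]) simp_all
  show "path_image ?g = (\<Union>s\<in>{(True, y0, min x0 x1, max x0 x1),
      (False, x1, min y0 y1, max y0 y1), (True, y1, min x1 x2, max x1 x2)}. axis_segment s)"
    using img seg by (simp add: path_image_join del: axis_segment.simps)
qed

lemma bend_path_vhv:
  assumes "y0 \<noteq> y1" "x0 \<noteq> x1" "y1 \<noteq> y2"
  obtains g where "bend_path 2 g" "path_image g = (\<Union>s\<in>{(False, x0, min y0 y1, max y0 y1),
    (True, y1, min x0 x1, max x0 x1), (False, x1, min y1 y2, max y1 y2)}. axis_segment s)"
proof
  let ?a = "Complex x0 y0" and ?b = "Complex x0 y1" and ?c = "Complex x1 y1" and ?d = "Complex x1 y2"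
  let ?g = "polyline [?a, ?b, ?c, ?d]"
  have seg: "closed_segment ?a ?b = axis_segment (False, x0, min y0 y1, max y0 y1)"
    "closed_segment ?b ?c = axis_segment (True, y1, min x0 x1, max x0 x1)"
    "closed_segment ?c ?d = axis_segment (False, x1, min y1 y2, max y1 y2)"
    by (simp_all only: closed_segment_horizontal closed_segment_vertical complex.sel)
  have on_seg: "z \<in> closed_segment ?a ?b \<Longrightarrow> Re z = x0" "z \<in> closed_segment ?b ?c \<Longrightarrow> Im z = y1"
    "z \<in> closed_segment ?c ?d \<Longrightarrow> Re z = x1" for z
    unfolding seg by simp_all
  have img: "path_image (linepath ?b ?c +++ linepath ?c ?d) = closed_segment ?b ?c \<union> closed_segment ?c ?d"
    by (simp add: path_image_join)
  have "arc (linepath ?b ?c +++ linepath ?c ?d)"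
  proof (rule arc_join)
    show "path_image (linepath ?b ?c) \<inter> path_image (linepath ?c ?d) \<subseteq> {pathstart (linepath ?c ?d)}"
    proof
      fix z assume "z \<in> path_image (linepath ?b ?c) \<inter> path_image (linepath ?c ?d)"
      then show "z \<in> {pathstart (linepath ?c ?d)}" using on_seg[of z] by (simp add: complex_eq_iff)
    qed
  qed (use assms in \<open>simp_all add: arc_linepath\<close>)
  then have "arc (linepath ?a ?b +++ (linepath ?b ?c +++ linepath ?c ?d))"
  proof (rule arc_join[rotated])
    show "path_image (linepath ?a ?b) \<inter> path_image (linepath ?b ?c +++ linepath ?c ?d)
      \<subseteq> {pathstart (linepath ?b ?c +++ linepath ?c ?d)}"
    proof
      fix z assume "z \<in> path_image (linepath ?a ?b) \<inter> path_image (linepath ?b ?c +++ linepath ?c ?d)"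
      then have "z \<in> closed_segment ?a ?b" "z \<in> closed_segment ?b ?c \<or> z \<in> closed_segment ?c ?d"
        unfolding img by simp_all
      then show "z \<in> {pathstart (linepath ?b ?c +++ linepath ?c ?d)}"
        using on_seg[of z] assms(2) by (simp add: complex_eq_iff) argo
    qed
  qed (use assms in \<open>simp_all add: arc_linepath\<close>)
  then have "arc ?g" by simp
  moreover have "\<forall>i\<le>2. horizontal ([?a, ?b, ?c, ?d] ! i) ([?a, ?b, ?c, ?d] ! (i + 1)) \<or>
      vertical ([?a, ?b, ?c, ?d] ! i) ([?a, ?b, ?c, ?d] ! (i + 1))"
    "\<forall>i<2. horizontal ([?a, ?b, ?c, ?d] ! i) ([?a, ?b, ?c, ?d] ! (i + 1)) \<longleftrightarrow>
      vertical ([?a, ?b, ?c, ?d] ! (i + 1)) ([?a, ?b, ?c, ?d] ! (i + 2))"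
    using assms by (simp_all add: numeral_2_eq_2 le_Suc_eq less_Suc_eq horizontal_def vertical_def all_conj_distrib)
  ultimately show "bend_path 2 ?g"
    unfolding bend_path_def
    by (intro conjI arc_imp_simple_path exI[of _ "[?a, ?b, ?c, ?d]"]) simp_all
  show "path_image ?g = (\<Union>s\<in>{(False, x0, min y0 y1, max y0 y1),
    (True, y1, min x0 x1, max x0 x1), (False, x1, min y1 y2, max y1 y2)}. axis_segment s)"
    using img seg by (simp add: path_image_join del: axis_segment.simps)
qed

text \<open>The vertex \<open>v\<close> has the column \<open>c v\<close>, and an inner vertex \<open>v\<close> also the row \<open>- c v\<close>. The leaves
  overlap along row \<open>0\<close> in their cyclic order, except for the last leaf \<open>w\<close>: it meets the
  first leaf and the last but one in their columns, and the root \<open>r\<close> in the row \<open>- 1\<close>, which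
  is used by no other vertex.\<close>

locale halin_layout =
  fixes V L :: "'a set" and n :: nat and c :: "'a \<Rightarrow> nat" and par :: "'a \<Rightarrow> 'a" and r w :: 'a
  assumes n: "3 \<le> n"
    and L: "L \<subseteq> V" "\<And>v. v \<in> V \<Longrightarrow> v \<in> L \<longleftrightarrow> c v < n"
    and inj: "inj_on c V"
    and r: "r \<in> V" "r \<notin> L"
    and w: "w \<in> L" "c w = n - 1" "par w = r"
    and par: "\<And>v. v \<in> V \<Longrightarrow> v \<noteq> r \<Longrightarrow> par v \<in> V \<and> par v \<notin> L \<and> c v < c (par v)"
begin

text \<open>On row \<open>0\<close> the length \<open>3 / 2\<close> passes the next column but not
  the one after it. The stub of length \<open>1 / 2\<close> on the row of the parent ends before the
  next column, so siblings stay apart, while the row itself runs from \<open>-1\<close> to the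
  higher-numbered column of the parent and covers the stub. All rows other than \<open>0\<close> and
  \<open>-1\<close> are at most \<open>- n\<close>. The legs of \<open>w\<close> stop at
  \<open>- 1 / 2\<close>, short of row \<open>0\<close>, and run inside the columns of the leaves
  numbered \<open>0\<close> and \<open>n - 2\<close>; these columns differ because
  \<open>3 \<le> n\<close>.\<close>

definition segments :: "'a \<Rightarrow> (bool \<times> real \<times> real \<times> real) set" where
  "segments v =
    (if v = r then {(True, -1, -1, real (c r)), (False, real (c r), - real (c r), -1), (True, - real (c r), -1, c r)}
     else if v = w then {(False, 0, -1, - 1 / 2), (True, -1, 0, real n - 2), (False, real n - 2, -1, - 1 / 2)}
     else if v \<in> L then {(True, 0, real (c v), real (c v) + 3 / 2), (False, real (c v), - real (c (par v)), 0),
       (True, - real (c (par v)), real (c v), real (c v) + 1 / 2)}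
     else {(True, - real (c v), -1, real (c v)), (False, real (c v), - real (c (par v)), - real (c v)),
       (True, - real (c (par v)), real (c v), real (c v) + 1 / 2)})"

definition adj :: "'a \<Rightarrow> 'a \<Rightarrow> bool" where
  "adj u v \<longleftrightarrow> u \<noteq> r \<and> par u = v \<or> v \<noteq> r \<and> par v = u \<or>
     u \<in> L \<and> v \<in> L \<and> (c v = Suc (c u) mod n \<or> c u = Suc (c v) mod n)"

definition meet :: "'a \<Rightarrow> 'a \<Rightarrow> bool" where
  "meet u v \<longleftrightarrow> (\<exists>s\<in>segments u. \<exists>t\<in>segments v. overlap s t)"

lemma finite_segments: "finite (segments v)"
  by (simp add: segments_def)

lemma overlap_commute: "overlap s t \<longleftrightarrow> overlap t s"
  by (cases s; cases t) (auto simp: max.commute min.commute)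

lemma meet_commute: "meet u v \<longleftrightarrow> meet v u"
  unfolding meet_def using overlap_commute by blast

lemma adj_commute: "adj u v \<longleftrightarrow> adj v u"
  by (auto simp: adj_def)

lemma c_inner: "v \<in> V \<Longrightarrow> v \<notin> L \<Longrightarrow> n \<le> c v"
  using L(2)[of v] by simp

lemma c_eq_iff: "u \<in> V \<Longrightarrow> v \<in> V \<Longrightarrow> c u = c v \<longleftrightarrow> u = v"
  using inj by (auto dest: inj_onD)

lemma w_neq_r: "w \<noteq> r" using w(1) r(2) by blast

lemma bend_path_segments:
  assumes v: "v \<in> V"
  shows "\<exists>g. bend_path 2 g \<and> path_image g = (\<Union>s\<in>segments v. axis_segment s)"
proof -
  have hvh: "\<exists>g. bend_path 2 g \<and> path_image g = (\<Union>s\<in>{(True, y0, min x0 x1, max x0 x1),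
    (False, x1, min y0 y1, max y0 y1), (True, y1, min x1 x2, max x1 x2)}. axis_segment s)"
    if "x0 \<noteq> x1" "y0 \<noteq> y1" "x1 \<noteq> x2" for x0 y0 x1 y1 x2
    using bend_path_hvh[OF that] by metis
  have vhv: "\<exists>g. bend_path 2 g \<and> path_image g = (\<Union>s\<in>{(False, x0, min y0 y1, max y0 y1),
    (True, y1, min x0 x1, max x0 x1), (False, x1, min y1 y2, max y1 y2)}. axis_segment s)"
    if "y0 \<noteq> y1" "x0 \<noteq> x1" "y1 \<noteq> y2" for x0 y0 x1 y1 y2
    using bend_path_vhv[OF that] by metis
  have "n \<le> c r" using c_inner r by simp
  consider "v = r" | "v = w" | "v \<noteq> r" "v \<noteq> w" "v \<in> L" | "v \<noteq> r" "v \<noteq> w" "v \<notin> L" by blast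
  then show ?thesis
  proof cases
    case 1
    have "segments v = {(True, -1, min (-1) (real (c r)), max (-1) (real (c r))),
      (False, real (c r), min (-1) (- real (c r)), max (-1) (- real (c r))),
      (True, - real (c r), min (real (c r)) (-1), max (real (c r)) (-1))}"
      using 1 \<open>n \<le> c r\<close> n by (simp add: segments_def min_def max_def)
    note seg = this
    show ?thesis unfolding seg by (rule hvh) (use \<open>n \<le> c r\<close> n in simp_all)
  next
    case 2
    have "segments v = {(False, 0, min (- 1 / 2) (-1), max (- 1 / 2) (-1)),
      (True, -1, min 0 (real n - 2), max 0 (real n - 2)),
      (False, real n - 2, min (-1) (- 1 / 2), max (-1) (- 1 / 2))}"
      using 2 n w_neq_r by (simp add: segments_def min_def max_def)
    note seg = this
    have "real n - 2 \<noteq> 0" using n by simp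
    then show ?thesis unfolding seg by (intro vhv) simp_all
  next
    case 3
    have "segments v = {(True, 0, min (real (c v) + 3 / 2) (real (c v)), max (real (c v) + 3 / 2) (real (c v))),
      (False, real (c v), min 0 (- real (c (par v))), max 0 (- real (c (par v)))),
      (True, - real (c (par v)), min (real (c v)) (real (c v) + 1 / 2), max (real (c v)) (real (c v) + 1 / 2))}"
      using 3 by (simp add: segments_def min_def max_def)
    note seg = this
    show ?thesis unfolding seg by (rule hvh) (use par[OF v 3(1)] in simp_all)
  next
    case 4
    have "segments v = {(True, - real (c v), min (-1) (real (c v)), max (-1) (real (c v))),
      (False, real (c v), min (- real (c v)) (- real (c (par v))), max (- real (c v)) (- real (c (par v)))),
      (True, - real (c (par v)), min (real (c v)) (real (c v) + 1 / 2), max (real (c v)) (real (c v) + 1 / 2))}"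
      using 4 par[OF v 4(1)] by (simp add: segments_def min_def max_def)
    note seg = this
    show ?thesis unfolding seg by (rule hvh) (use par[OF v 4(1)] in simp_all)
  qed
qed

section \<open>Overlaps in the layout for each pair of vertex types\<close>

lemma meet_root_last: "meet r w \<and> adj r w"
  using n c_inner[OF r] w_neq_r w(3) by (simp add: meet_def adj_def segments_def)

lemma meet_root_leaf:
  assumes "v \<in> L" "v \<noteq> w"
  shows "meet r v \<longleftrightarrow> adj r v"
proof -
  have v: "v \<in> V" "v \<noteq> r" "c v < n" using assms L r by auto
  have "n \<le> c r" using c_inner r by simp
  have p: "par v \<in> V" "n \<le> c (par v)" using par[OF v(1,2)] c_inner by auto
  have "meet r v \<longleftrightarrow> c (par v) = c r"
    using n \<open>n \<le> c r\<close> v p assms by (auto simp: meet_def segments_def)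
  then show ?thesis using c_eq_iff[OF p(1) r(1)] v r by (auto simp: adj_def)
qed

lemma meet_root_inner:
  assumes "v \<in> V" "v \<notin> L" "v \<noteq> r"
  shows "meet r v \<longleftrightarrow> adj r v"
proof -
  have "v \<noteq> w" using assms w by auto
  have "n \<le> c r" "n \<le> c v" using c_inner r assms by simp_all
  have p: "par v \<in> V" "n \<le> c (par v)" "c v < c (par v)" using par[OF assms(1,3)] c_inner by auto
  have "c v \<noteq> c r" using c_eq_iff assms r by simp
  have "meet r v \<longleftrightarrow> c (par v) = c r"
    using n \<open>n \<le> c r\<close> \<open>n \<le> c v\<close> \<open>c v \<noteq> c r\<close> p assms \<open>v \<noteq> w\<close> by (auto simp: meet_def segments_def)
  then show ?thesis using c_eq_iff[OF p(1) r(1)] assms r by (auto simp: adj_def)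
qed

lemma meet_last_leaf:
  assumes "v \<in> L" "v \<noteq> w"
  shows "meet w v \<longleftrightarrow> adj w v"
proof -
  have v: "v \<in> V" "v \<noteq> r" "c v < n" using assms L r by auto
  have p: "par v \<in> V" "par v \<notin> L" "n \<le> c (par v)" using par[OF v(1,2)] c_inner by auto
  have "c v \<noteq> c w" using c_eq_iff[of v w] assms w L v by auto
  \<comment> \<open>As \<open>3 \<le> n\<close>, subtraction on naturals is not truncated here, and
    columns can be compared as natural numbers.\<close>
  have nn: "real n - 2 = real (n - 2)" using n by simp
  have "meet w v \<longleftrightarrow> c v = 0 \<or> c v = n - 2"
    using n v p assms w_neq_r unfolding meet_def segments_def nn by auto
  \<comment> \<open>Position \<open>n - 1\<close> of \<open>w\<close> has the cyclic neighbours
    \<open>0\<close> and \<open>n - 2\<close>.\<close>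
  also have "\<dots> \<longleftrightarrow> adj w v"
    using p w assms r n v \<open>c v \<noteq> c w\<close> by (auto simp: adj_def mod_Suc)
  finally show ?thesis .
qed

text \<open>An inner vertex other than the root stays at height at most \<open>- n\<close>, whereas
  \<open>w\<close> stays at height \<open>-1\<close> or above.\<close>

lemma meet_last_inner:
  assumes "v \<in> V" "v \<notin> L" "v \<noteq> r"
  shows "meet w v \<longleftrightarrow> adj w v"
proof -
  have "v \<noteq> w" using assms w by auto
  have "n \<le> c v" using c_inner assms by simp
  have p: "par v \<in> V" "par v \<notin> L" "n \<le> c (par v)" "c v < c (par v)" using par[OF assms(1,3)] c_inner by auto
  have nn: "real n - 2 = real (n - 2)" using n by simp
  have "\<not> meet w v"
    using n \<open>n \<le> c v\<close> p assms \<open>v \<noteq> w\<close> w_neq_r unfolding meet_def segments_def nn by auto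
  moreover have "\<not> adj w v" using assms p w by (auto simp: adj_def)
  ultimately show ?thesis by simp
qed

lemma meet_leaves:
  assumes "u \<in> L" "u \<noteq> w" "v \<in> L" "v \<noteq> w" "u \<noteq> v"
  shows "meet u v \<longleftrightarrow> adj u v"
proof -
  have v: "v \<in> V" "v \<noteq> r" "c v < n" and u: "u \<in> V" "u \<noteq> r" "c u < n" using assms L r by auto
  have p: "par v \<notin> L" "n \<le> c (par v)" "par u \<notin> L" "n \<le> c (par u)"
    using par[OF v(1,2)] par[OF u(1,2)] c_inner by auto
  have "c u \<noteq> c v" "c u \<noteq> c w" "c v \<noteq> c w" using c_eq_iff u v assms w(1) L(1) by auto
  have "meet u v \<longleftrightarrow> c v = Suc (c u) \<or> c u = Suc (c v)"
    using n u v p assms \<open>c u \<noteq> c v\<close> by (auto simp: meet_def segments_def)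
  \<comment> \<open>Without \<open>w\<close> both positions are below \<open>n - 1\<close>, so the
    successor never wraps around.\<close>
  also have "\<dots> \<longleftrightarrow> adj u v"
    using p assms u v w(2) n \<open>c u \<noteq> c w\<close> \<open>c v \<noteq> c w\<close> by (auto simp: adj_def mod_Suc)
  finally show ?thesis .
qed

lemma meet_leaf_inner:
  assumes "u \<in> L" "u \<noteq> w" "v \<in> V" "v \<notin> L" "v \<noteq> r"
  shows "meet u v \<longleftrightarrow> adj u v"
proof -
  have u: "u \<in> V" "u \<noteq> r" "c u < n" using assms L r by auto
  have "v \<noteq> w" using assms w by auto
  have "n \<le> c v" using c_inner assms by simp
  have p: "n \<le> c (par v)" "par v \<notin> L" "par u \<in> V" "n \<le> c (par u)"
    using par[OF assms(3,5)] par[OF u(1,2)] c_inner by auto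
  have "meet u v \<longleftrightarrow> c (par u) = c v"
    using n u p assms \<open>n \<le> c v\<close> \<open>v \<noteq> w\<close> by (auto simp: meet_def segments_def)
  then show ?thesis using c_eq_iff[OF p(3) assms(3)] assms u p by (auto simp: adj_def)
qed

text \<open>Distinct vertices have distinct rows and columns, and stubs on the same row are
  disjoint. What remains is a stub of one vertex on the row of the other, which is exactly the
  parent relation.\<close>

lemma meet_inner:
  assumes "u \<in> V" "u \<notin> L" "u \<noteq> r" "v \<in> V" "v \<notin> L" "v \<noteq> r" "u \<noteq> v"
  shows "meet u v \<longleftrightarrow> adj u v"
proof -
  have "v \<noteq> w" "u \<noteq> w" using assms w by auto
  have "n \<le> c v" "n \<le> c u" using c_inner assms by simp_all
  have "c u \<noteq> c v" using c_eq_iff assms by simp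
  have p: "par v \<in> V" "c v < c (par v)" "par u \<in> V" "c u < c (par u)"
    using par[OF assms(1,3)] par[OF assms(4,6)] by auto
  have "meet u v \<longleftrightarrow> c (par u) = c v \<or> c (par v) = c u"
    using n p assms \<open>n \<le> c v\<close> \<open>n \<le> c u\<close> \<open>c u \<noteq> c v\<close> \<open>v \<noteq> w\<close> \<open>u \<noteq> w\<close>
    by (auto simp: meet_def segments_def)
  then show ?thesis using c_eq_iff[OF p(3) assms(4)] c_eq_iff[OF p(1) assms(1)] assms by (auto simp: adj_def)
qed

lemma meet_iff_adj:
  assumes "u \<in> V" "v \<in> V" "u \<noteq> v"
  shows "meet u v \<longleftrightarrow> adj u v"
proof -
  note all_cases = meet_root_last meet_root_leaf meet_root_inner meet_last_leaf meet_last_inner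
    meet_leaves meet_leaf_inner meet_inner
  show ?thesis
    using assms all_cases meet_commute adj_commute by metis
qed

lemma EPG_representation_layout:
  assumes E: "\<And>u v. u \<in> V \<Longrightarrow> v \<in> V \<Longrightarrow> u \<noteq> v \<Longrightarrow> {u, v} \<in> E \<longleftrightarrow> adj u v"
  shows "\<exists>P. EPG_representation 2 V E P"
proof -
  obtain P where P: "\<And>v. v \<in> V \<Longrightarrow> bend_path 2 (P v) \<and> path_image (P v) = (\<Union>s\<in>segments v. axis_segment s)"
    using bend_path_segments by metis
  have "share_segment (P u) (P v) \<longleftrightarrow> adj u v" if "u \<in> V" "v \<in> V" "u \<noteq> v" for u v
    using share_segment_iff_overlap[OF finite_segments finite_segments, of "P u" u "P v" v]
      P[OF that(1)] P[OF that(2)] meet_iff_adj[OF that] unfolding meet_def by blast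
  then have "EPG_representation 2 V E P"
    unfolding EPG_representation_def using P E by blast
  then show ?thesis by blast
qed

end

section \<open>From a tree with a leaf cycle to the layout\<close>

lemma leaf_unique_edge:
  assumes "v \<in> leaves V T" "e \<in> T" "v \<in> e" "f \<in> T" "v \<in> f"
  shows "e = f"
proof -
  have "card {e \<in> T. v \<in> e} = 1"
    using assms(1) by (simp add: leaves_def vertex_degree_def)
  then obtain g where "{e \<in> T. v \<in> e} = {g}" by (rule card_1_singletonE)
  moreover have "e \<in> {e \<in> T. v \<in> e}" "f \<in> {e \<in> T. v \<in> e}" using assms(2-5) by simp_all
  ultimately show ?thesis by (metis singletonD)
qed

lemma cycle_graph_edge_iff:
  assumes "distinct vs" "i < length vs" "j < length vs"
  shows "{vs ! i, vs ! j} \<in> {{vs ! k, vs ! (Suc k mod length vs)} |k. k < length vs} \<longleftrightarrow>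
    j = Suc i mod length vs \<or> i = Suc j mod length vs"
proof
  assume "{vs ! i, vs ! j} \<in> {{vs ! k, vs ! (Suc k mod length vs)} |k. k < length vs}"
  then obtain k where k: "k < length vs" "{vs ! i, vs ! j} = {vs ! k, vs ! (Suc k mod length vs)}"
    by blast
  have "Suc k mod length vs < length vs" using k(1) by (intro mod_less_divisor) auto
  then have "i = k \<and> j = Suc k mod length vs \<or> i = Suc k mod length vs \<and> j = k"
    using k assms by (simp add: doubleton_eq_iff nth_eq_iff_index_eq)
  then show "j = Suc i mod length vs \<or> i = Suc j mod length vs" by blast
next
  assume "j = Suc i mod length vs \<or> i = Suc j mod length vs"
  then show "{vs ! i, vs ! j} \<in> {{vs ! k, vs ! (Suc k mod length vs)} |k. k < length vs}"
  proof
    assume "j = Suc i mod length vs"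
    then show ?thesis using assms(2) by blast
  next
    assume "i = Suc j mod length vs"
    then have "{vs ! i, vs ! j} = {vs ! j, vs ! (Suc j mod length vs)}" by (simp add: insert_commute)
    then show ?thesis using assms(3) by blast
  qed
qed

lemma tree_plus_leaf_cycle_EPG:
  assumes T: "tree_graph V T" and C: "cycle_graph (leaves V T) C"
  shows "\<exists>P. EPG_representation 2 V (T \<union> C) P"
proof -
  let ?L = "leaves V T"
  obtain vs where vs: "distinct vs" "3 \<le> length vs" "set vs = ?L"
    and C_eq: "C = {{vs ! i, vs ! (Suc i mod length vs)} |i. i < length vs}"
    using C unfolding cycle_graph_def by blast
  define n where "n = length vs"
  have n: "3 \<le> n" using vs(2) by (simp add: n_def)
  have LV: "?L \<subseteq> V" by (auto simp: leaves_def)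
  have T2: "e \<subseteq> V \<and> card e = 2" if "e \<in> T" for e
    using T that by (simp add: tree_graph_def simple_graph_def)
  have finV: "finite V" using T by (simp add: tree_graph_def simple_graph_def)
  \<comment> \<open>The last leaf of the list carries the edge that wraps around.\<close>
  define w where "w = vs ! (n - 1)"
  have w: "w \<in> ?L" using n vs(3) unfolding w_def n_def by (metis diff_less less_le_trans nth_mem zero_less_numeral zero_less_one)
  have "card {e \<in> T. w \<in> e} = 1" using w by (simp add: leaves_def vertex_degree_def)
  then obtain e where "{e \<in> T. w \<in> e} = {e}" by (rule card_1_singletonE)
  then have "e \<in> {e \<in> T. w \<in> e}" by (metis insertI1)
  then have e: "e \<in> T" "w \<in> e" by simp_all
  have "card e = 2" "e \<subseteq> V" using T2[OF e(1)] by simp_all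
  then obtain r where r: "e = {w, r}" "r \<noteq> w" "r \<in> V"
    using e(2) by (auto simp: card_2_iff)
  obtain num :: "'a \<Rightarrow> nat" and par where num: "inj_on num V" "\<forall>v\<in>V. num v < card V"
    and pars: "\<forall>v\<in>V - {r}. par v \<in> V \<and> num (par v) < num v"
    and T_eq: "T = (\<lambda>v. {v, par v}) ` (V - {r})"
    by (rule tree_graph_parents[OF T r(3)])
  note num = num(1) num(2)[rule_format]
  have par: "par v \<in> V \<and> num (par v) < num v" if "v \<in> V - {r}" for v using pars that by blast
  have par_edge: "{v, par v} \<in> T" if "v \<in> V" "v \<noteq> r" for v
    using that by (simp add: T_eq)
  \<comment> \<open>A parent other than the root lies on two edges, to its child and to its own
    parent. They differ because \<open>num\<close> strictly decreases towards the root.\<close>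
  have par_not_leaf: "par v \<notin> ?L" if v: "v \<in> V" "v \<noteq> r" "par v \<noteq> r" for v
  proof
    assume leaf: "par v \<in> ?L"
    have pv: "par v \<in> V" "num (par v) < num v" using par v by auto
    have pp: "num (par (par v)) < num (par v)" using par pv(1) v(3) by auto
    have "{v, par v} = {par v, par (par v)}"
      by (rule leaf_unique_edge[OF leaf par_edge[OF v(1,2)] _ par_edge[OF pv(1) v(3)]]) simp_all
    then show False using pv(2) pp by (auto simp: doubleton_eq_iff)
  qed
  have par_w: "par w = r"
  proof -
    have "w \<in> V" using w LV by blast
    have "{w, r} = {w, par w}"
      by (rule leaf_unique_edge[OF w _ _ par_edge[OF \<open>w \<in> V\<close>]]) (use e r in auto)
    then show ?thesis using r(2) by (auto simp: doubleton_eq_iff)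
  qed
  \<comment> \<open>If the root were a leaf, \<open>{w, r}\<close> would be its only edge, so
    \<open>w\<close> would be its only child. As the leaf \<open>w\<close> is nobody's parent, the
    tree would have just two vertices, fewer than the leaves on the cycle.\<close>
  have r_not_leaf: "r \<notin> ?L"
  proof
    assume leaf: "r \<in> ?L"
    have "v \<in> {r, w}" if "v \<in> V" for v
      using that
    proof (induction "num v" arbitrary: v rule: less_induct)
      case less
      show ?case
      proof (cases "v = r")
        case False
        then have pv: "par v \<in> V" "num (par v) < num v" using par less.prems by auto
        then have "par v \<in> {r, w}" by (intro less.hyps)
        then have "par v = r" using par_not_leaf[OF less.prems False] w by auto
        have "{v, r} = {w, r}"
          by (rule leaf_unique_edge[OF leaf]) (use par_edge[OF less.prems False] \<open>par v = r\<close> e r in auto)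
        then show ?thesis by (auto simp: doubleton_eq_iff)
      qed simp
    qed
    then have "set vs \<subseteq> {r, w}" using vs(3) LV by blast
    then have "card (set vs) \<le> 2" using card_mono[of "{r, w}" "set vs"] by (simp add: card_insert_if split: if_splits)
    then show False using distinct_card[OF vs(1)] vs(2) by simp
  qed
  have par_not_leaf: "par v \<notin> ?L" if "v \<in> V" "v \<noteq> r" for v
    using par_not_leaf[OF that] r_not_leaf by auto
  define pos where "pos v = the_inv_into {..<n} ((!) vs) v" for v
  have inj_vs: "inj_on ((!) vs) {..<n}" using vs(1) by (auto simp: n_def inj_on_def nth_eq_iff_index_eq)
  have pos: "pos v < n" "vs ! pos v = v" if "v \<in> ?L" for v
  proof -
    have "v \<in> set vs" using that vs(3) by simp
    then obtain i where "i < n" "v = vs ! i" unfolding n_def by (metis in_set_conv_nth)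
    then have "v \<in> (!) vs ` {..<n}" by simp
    then show "pos v < n" "vs ! pos v = v"
      using the_inv_into_into[OF inj_vs _ subset_refl] f_the_inv_into_f[OF inj_vs] by (auto simp: pos_def)
  qed
  \<comment> \<open>\<open>num\<close> grows away from the root but \<open>c\<close> must grow
    towards it, hence the reversal. Since \<open>num v < card V\<close>, the subtraction is not
    truncated and remains injective; the offset \<open>n\<close> reserves the first columns for the
    leaves.\<close>
  define c where "c v = (if v \<in> ?L then pos v else n + (card V - num v))" for v
  have c_inj: "inj_on c V"
  proof (rule inj_onI)
    fix u v assume uv: "u \<in> V" "v \<in> V" "c u = c v"
    show "u = v"
    proof -
      consider "u \<in> ?L" "v \<in> ?L" | "u \<in> ?L" "v \<notin> ?L" | "u \<notin> ?L" "v \<in> ?L" | "u \<notin> ?L" "v \<notin> ?L" by blast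
      then show ?thesis
      proof cases
        case 1
        then have "pos u = pos v" using uv(3) by (simp add: c_def)
        then show ?thesis using pos(2)[OF 1(1)] pos(2)[OF 1(2)] by metis
      next
        case 2
        then show ?thesis using uv(3) pos(1)[OF 2(1)] by (simp add: c_def)
      next
        case 3
        then show ?thesis using uv(3) pos(1)[OF 3(2)] by (simp add: c_def)
      next
        case 4
        then have "num u = num v" using uv(3) num(2)[OF uv(1)] num(2)[OF uv(2)] by (simp add: c_def)
        then show ?thesis using inj_onD[OF num(1)] uv by blast
      qed
    qed
  qed
  have pos_w: "pos w = n - 1"
    using n by (simp add: pos_def w_def the_inv_into_f_f[OF inj_vs])
  interpret halin_layout V ?L n c par r w
  proof
    show "3 \<le> n" "?L \<subseteq> V" "inj_on c V" "r \<in> V" "r \<notin> ?L" "w \<in> ?L" "par w = r" by fact+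
    show "v \<in> ?L \<longleftrightarrow> c v < n" if "v \<in> V" for v using pos(1) by (simp add: c_def)
    show "c w = n - 1" using w pos_w by (simp add: c_def)
    show "par v \<in> V \<and> par v \<notin> ?L \<and> c v < c (par v)" if v: "v \<in> V" "v \<noteq> r" for v
    proof -
      have p: "par v \<in> V" "num (par v) < num v" "par v \<notin> ?L" using par par_not_leaf v by auto
      then show ?thesis using pos(1)[of v] num(2)[OF v(1)] by (auto simp: c_def)
    qed
  qed
  have "{u, v} \<in> T \<union> C \<longleftrightarrow> adj u v" if uv: "u \<in> V" "v \<in> V" "u \<noteq> v" for u v
  proof -
    have "{u, v} \<in> T \<longleftrightarrow> u \<noteq> r \<and> par u = v \<or> v \<noteq> r \<and> par v = u"
      using uv by (auto simp: T_eq doubleton_eq_iff image_iff)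
    moreover have "{u, v} \<in> C \<longleftrightarrow> u \<in> ?L \<and> v \<in> ?L \<and> (c v = Suc (c u) mod n \<or> c u = Suc (c v) mod n)"
    proof (cases "u \<in> ?L \<and> v \<in> ?L")
      case True
      have edge: "{vs ! pos u, vs ! pos v} \<in> C \<longleftrightarrow> pos v = Suc (pos u) mod n \<or> pos u = Suc (pos v) mod n"
        unfolding C_eq n_def
        by (rule cycle_graph_edge_iff[OF vs(1)]) (use True pos(1) in \<open>simp_all add: n_def\<close>)
      have uv_pos: "vs ! pos u = u" "vs ! pos v = v" using True pos(2) by simp_all
      have "c u = pos u" "c v = pos v" using True by (simp_all add: c_def)
      then show ?thesis using edge[unfolded uv_pos] True by simp
    next
      case False
      have "e \<subseteq> ?L" if eC: "e \<in> C" for e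
      proof -
        obtain i where i: "i < length vs" "e = {vs ! i, vs ! (Suc i mod length vs)}"
          using eC unfolding C_eq by blast
        have "Suc i mod length vs < length vs" using i(1) by (intro mod_less_divisor) auto
        then show ?thesis using i nth_mem unfolding vs(3)[symmetric] by simp
      qed
      then have "{u, v} \<notin> C" using False by (metis insert_subset)
      then show ?thesis using False by blast
    qed
    ultimately show ?thesis unfolding adj_def by blast
  qed
  then show ?thesis by (rule EPG_representation_layout)
qed

lemma halin_EPG_bend_number_le:
  assumes "halin_graph V E"
  shows "EPG_bend_number V E \<le> 2"
proof -
  obtain T C where "E = T \<union> C" "tree_graph V T" "cycle_graph (leaves V T) C"
    using assms unfolding halin_graph_def by blast
  then have "2 \<in> {k. \<exists>P. EPG_representation k V E P}"
    using tree_plus_leaf_cycle_EPG by blast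
  then have "EPG_bend_number V E \<le> enat 2"
    unfolding EPG_bend_number_def by (rule INF_lower)
  then show ?thesis by (simp add: numeral_eq_enat)
qed

theorem corollary2:
  shows "(\<forall>(V :: 'a set) E. halin_graph V E \<longrightarrow> EPG_bend_number V E \<le> 2) \<and>
         (\<exists>(V :: nat set) E. halin_graph V E \<and> EPG_bend_number V E = 2)"
proof -
  have "enat 2 \<le> EPG_bend_number {0..5} (W5_spokes \<union> C5_edges)"
    unfolding EPG_bend_number_def
  proof (rule INF_greatest)
    fix k assume "k \<in> {k. \<exists>P. EPG_representation k {0..5} (W5_spokes \<union> C5_edges) P}"
    then have "\<not> k \<le> 1" using W5_no_EPG by blast
    then show "enat 2 \<le> enat k" by simp
  qed
  then have "EPG_bend_number {0..5} (W5_spokes \<union> C5_edges) = 2"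
    using halin_EPG_bend_number_le[OF halin_W5] by (simp add: numeral_eq_enat antisym)
  then show ?thesis using halin_EPG_bend_number_le halin_W5 by blast
qed

end
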